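(* Let $\{X^k\}_{k\ge0}=\{(X_0^k,\dots,X_M^k)\}_{k\ge0}$ be generated from an initial point $X^0$ by the proximal block coordinate descent updates, performed at each iteration $k$ in the order $i=M,M-1,\dots,1,0$: $$X_i^{k+1}=\Pi_{\widetilde\Gamma_+^n}(\Delta_i^k)\quad(i=M,\dots,1),\qquad X_0^{k+1}=\Pi_{\widetilde\Gamma_+^p}(\Delta_0^k),$$ $$\Delta_i^k=\rho_i^{-1}\big(H_i(X_{-i}^k)+\rho_iX_i^k-L_iX_i^k\big),$$ where $X_{-i}^k=(X_0^k,\dots,X_{i-1}^k,X_{i+1}^{k+1},\dots,X_M^{k+1})$. Let $\Omega^*$ be the optimal value of $\min_{X}\Omega(X_0,\dots,X_M)$. Then $$\Omega(X^k)-\Omega^*\le\mathcal O\Big(\frac1k\Big)\qquad\text{for all }k\ge1,$$ i.e. there is a constant $c$ independent of $k$ with $\Omega(X^k)-\Omega^*\le c/k$ for all $k\ge1$.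
   Context: Data. Let $m,n,l,q,M\ge1$, $p=m+n$; $A,B_2,B_1,C,D$ real matrices of sizes $n\times n$, $n\times m$, $n\times l$, $q\times n$, $q\times m$; $Q=\begin{bmatrix}B_1B_1^\top&0\\0&0\end{bmatrix}$, $R=\begin{bmatrix}C^\top C&0\\0&D^\top D\end{bmatrix}\in\mathbb S^p$ (symmetric matrices); $F_i=\begin{bmatrix}A_i&B_{2,i}\\0&0\end{bmatrix}\in\mathbb R^{p\times p}$, $i=1,\dots,M$; $V_2=[I_n,0]\in\mathbb R^{n\times p}$; $\Upsilon_i(W)=-V_2(F_iW+WF_i^\top+Q)V_2^\top$. Standing assumptions. (1) $C^\top D=0$, $D^\top D\succ0$, $C^\top C\succ0$, $B_1B_1^\top\succ0$, $(A,B_2)$ stabilizable, $(A,C)$ without unobservable modes on the imaginary axis. (2) $\begin{bmatrix}A&B_2\\0&0\end{bmatrix}$ is a convex combination of $F_1,\dots,F_M$. (3) There is $W\in\mathbb S^p$ with $W\succ0$ and $\Upsilon_i(W)\succ0$ for all $i$. (4) Every $W\in\mathbb S^p$ with $W\succeq0$ and $\Upsilon_i(W)\succeq0$ for all $i$ has positive definite upper-left $n\times n$ block. Notation. $\mathrm{vec}$ stacks columns. For $S\in\mathbb S^k$, $\mathrm{svec}(S)\in\mathbb R^{k(k+1)/2}$ lists the entries of one triangle of $S$ (each once, without scaling); $\widetilde\Gamma_+^k=\{\mathrm{svec}(S):S\in\mathbb S^k,S\succeq0\}$; $\Pi_E$ is the Euclidean projection onto $E$ and $\delta_E$ the indicator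 function. $D_1$ is the matrix with $\mathrm{vec}(W)=D_1\mathrm{svec}(W)$ for $W\in\mathbb S^p$, and $T_2$ a matrix with $\mathrm{svec}(S)=T_2\mathrm{vec}(S)$ for $S\in\mathbb S^n$. Fix $\beta>0$ and a vector $\xi_n\in\mathbb R^{p^2}$ (in the paper $\xi_n=\widetilde W_n+\beta^{-1}u_n$ for current outer iterates $\widetilde W_n,u_n$). Put $\Xi_i=V_2\otimes V_2F_i+V_2F_i\otimes V_2$ and, for $X_0\in\mathbb R^{p(p+1)/2}$, $X_1,\dots,X_M\in\mathbb R^{n(n+1)/2}$, $$\mathcal L^\star(X_0,\dots,X_M)=D_1^\top\mathrm{vec}(R)-X_0+D_1^\top\sum_{i=1}^M\Xi_i^\top T_2^\top X_i,$$ $$\begin{aligned}\Omega(X_0,\dots,X_M)=&-\Big\langle\sum_{i=1}^MX_i,\,T_2(V_2\otimes V_2)\mathrm{vec}(Q)\Big\rangle-\langle\mathcal L^\star(X),(D_1^\top D_1)^{-1}D_1^\top\xi_n\rangle\\&+\frac1{2\beta}\|(D_1^\top D_1)^{-1/2}\mathcal L^\star(X)\|^2+\delta_{\widetilde\Gamma_+^p}(X_0)+\sum_{i=1}^M\delta_{\widetilde\Gamma_+^n}(X_i).\end{aligned}$$ Let $\mathcal L^\star(X_{-i})=\mathcal L^\star(X)-D_1^\top\Xi_i^\top T_2^\top X_i$ for $i\ge1$ and $\mathcal L^\star(X_{-0})=\mathcal L^\star(X)+X_0$ (the parts not depending on $X_i$, resp. $X_0$). For $i\ge1$, $$L_i=\tfrac1\beta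 T_2\Xi_iD_1(D_1^\top D_1)^{-1}D_1^\top\Xi_i^\top T_2^\top,$$ $$H_i(X_{-i})=T_2(V_2\otimes V_2)\mathrm{vec}(Q)+T_2\Xi_iD_1(D_1^\top D_1)^{-1}D_1^\top\xi_n-\tfrac1\beta T_2\Xi_iD_1(D_1^\top D_1)^{-1}\mathcal L^\star(X_{-i});$$ and $L_0=\tfrac1\beta(D_1^\top D_1)^{-1}$, $H_0(X_{-0})=-(D_1^\top D_1)^{-1}D_1^\top\xi_n+\tfrac1\beta(D_1^\top D_1)^{-1}\mathcal L^\star(X_{-0})$. Finally $\rho_i$ is the largest eigenvalue of $L_i$, $i=0,\dots,M$. *)

theory Defs
  imports "HOL-Analysis.Analysis" "HOL-Library.Uprod"
begin

instance uprod :: (finite) finite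
  by standard simp

definition sym_mat :: "real^'k^'k \<Rightarrow> bool" where
  "sym_mat S \<longleftrightarrow> transpose S = S"

definition psd :: "real^'k^'k \<Rightarrow> bool" where
  "psd S \<longleftrightarrow> sym_mat S \<and> (\<forall>x. 0 \<le> x \<bullet> (S *v x))"

definition posdef :: "real^'k^'k \<Rightarrow> bool" where
  "posdef S \<longleftrightarrow> sym_mat S \<and> (\<forall>x. x \<noteq> 0 \<longrightarrow> 0 < x \<bullet> (S *v x))"

definition psd_sqrt :: "real^'k^'k \<Rightarrow> real^'k^'k" where
  "psd_sqrt S = (THE P. psd P \<and> P ** P = S)"

definition eigenpair :: "'a::field^'k^'k \<Rightarrow> 'a \<Rightarrow> 'a^'k \<Rightarrow> bool" where
  "eigenpair S c v \<longleftrightarrow> v \<noteq> 0 \<and> S *v v = c *s v"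

definition max_eigenvalue :: "real^'k^'k \<Rightarrow> real" where
  "max_eigenvalue S = (GREATEST c. \<exists>v. eigenpair S c v)"

abbreviation complex_mat :: "real^'j^'i \<Rightarrow> complex^'j^'i" where
  "complex_mat \<equiv> map_matrix complex_of_real"

definition hurwitz :: "real^'n^'n \<Rightarrow> bool" where
  "hurwitz A \<longleftrightarrow> (\<forall>c v. eigenpair (complex_mat A) c v \<longrightarrow> Re c < 0)"

definition stabilizable :: "real^'n^'n \<Rightarrow> real^'m^'n \<Rightarrow> bool" where
  "stabilizable A B \<longleftrightarrow> (\<exists>K :: real^'n^'m. hurwitz (A + B ** K))"

text \<open>A mode (eigenvalue) of \<open>A\<close> is unobservable for \<open>(A, C)\<close> if \<open>C\<close> annihilates one of its
  eigenvectors.\<close>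

definition unobservable_mode :: "real^'n^'n \<Rightarrow> real^'n^'q \<Rightarrow> complex \<Rightarrow> bool" where
  "unobservable_mode A C c \<longleftrightarrow> (\<exists>v. eigenpair (complex_mat A) c v \<and> complex_mat C *v v = 0)"

text \<open>The dimension \<open>p = m + n\<close> is carried by the index type \<open>'n + 'm\<close>, the \<open>n\<close>-part first.\<close>

definition block_mat ::
  "real^'n^'n \<Rightarrow> real^'m^'n \<Rightarrow> real^'n^'m \<Rightarrow> real^'m^'m \<Rightarrow> real^('n + 'm)^('n + 'm)" where
  "block_mat P11 P12 P21 P22 = (\<chi> i j. case i of
      Inl a \<Rightarrow> (case j of Inl b \<Rightarrow> P11 $ a $ b | Inr b \<Rightarrow> P12 $ a $ b)
    | Inr a \<Rightarrow> (case j of Inl b \<Rightarrow> P21 $ a $ b | Inr b \<Rightarrow> P22 $ a $ b))"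

definition upper_left :: "real^('n::finite + 'm::finite)^('n + 'm) \<Rightarrow> real^'n^'n" where
  "upper_left W = (\<chi> i j. W $ Inl i $ Inl j)"

definition V2 :: "real^('n::finite + 'm::finite)^'n" where
  "V2 = (\<chi> i j. case j of Inl b \<Rightarrow> mat 1 $ i $ b | Inr _ \<Rightarrow> 0)"

definition Upsilon ::
  "real^('n::finite + 'm::finite)^('n + 'm) \<Rightarrow> real^('n + 'm)^('n + 'm) \<Rightarrow> real^('n + 'm)^('n + 'm) \<Rightarrow> real^'n^'n" where
  "Upsilon Q Fi W = - (V2 ** (Fi ** W + W ** transpose Fi + Q) ** transpose V2)"

text \<open>Stacking columns: the position of an entry in the stacked vector is the pair
  (column, row), where the column index is the major one.  The Kronecker product uses the same
  convention, so that \<open>kron A B *v vec_mat W = vec_mat (B ** W ** transpose A)\<close>.\<close>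

definition vec_mat :: "real^'j^'i \<Rightarrow> real^('j \<times> 'i)" where
  "vec_mat W = (\<chi> ji. W $ snd ji $ fst ji)"

definition kron :: "real^'b^'a \<Rightarrow> real^'d^'c \<Rightarrow> real^('b \<times> 'd)^('a \<times> 'c)" where
  "kron A B = (\<chi> i j. A $ fst i $ fst j * B $ snd i $ snd j)"

text \<open>The positions of a triangle (diagonal included) of a \<open>k \<times> k\<close> matrix are indexed by the
  unordered pairs of indices; there are \<open>k (k + 1) / 2\<close> of them (lemma \<open>card_UNIV_uprod\<close>).
  From each pair of mirrored positions one is chosen, and the entry there is listed without
  scaling.  For symmetric \<open>S\<close> the choice is immaterial:
  \<open>svec S $ Upair i j = S $ i $ j\<close>.\<close>

definition tri_pos :: "'k uprod \<Rightarrow> 'k \<times> 'k" where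
  "tri_pos u = (SOME ij. Upair (fst ij) (snd ij) = u)"

definition svec :: "real^'k^'k \<Rightarrow> real^('k uprod)" where
  "svec S = (\<chi> u. S $ fst (tri_pos u) $ snd (tri_pos u))"

lemma svec_Upair:
  assumes "sym_mat S"
  shows "svec S $ Upair i j = S $ i $ j"
proof -
  obtain a b where ab: "tri_pos (Upair i j) = (a, b)"
    by fastforce
  have "Upair (fst (tri_pos (Upair i j))) (snd (tri_pos (Upair i j))) = Upair i j"
    unfolding tri_pos_def by (rule someI[of _ "(i, j)"]) simp
  then have "(a = i \<and> b = j) \<or> (a = j \<and> b = i)"
    by (simp add: ab)
  moreover have "S $ j $ i = S $ i $ j"
    using assms by (simp add: sym_mat_def transpose_def vec_eq_iff)
  ultimately show ?thesis
    by (elim disjE conjE) (simp_all add: svec_def ab)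
qed

definition Gamma_plus :: "(real^('k::finite uprod)) set" where
  "Gamma_plus = {svec S | S. psd S}"

definition indicator_ereal :: "'a set \<Rightarrow> 'a \<Rightarrow> ereal" where
  "indicator_ereal E x = (if x \<in> E then 0 else \<infinity>)"

definition Xi ::
  "real^('n::finite + 'm::finite)^('n + 'm) \<Rightarrow> real^(('n + 'm) \<times> ('n + 'm))^('n \<times> 'n)" where
  "Xi Fi = kron V2 (V2 ** Fi) + kron (V2 ** Fi) V2"

text \<open>A block vector \<open>(X\<^sub>0, X\<^sub>1, \<dots>, X\<^sub>M)\<close> is given by \<open>X0\<close> together with a function \<open>X\<close> of
  which only the values on \<open>{1..M}\<close> matter.\<close>

definition Lstar ::
  "real^('n::finite + 'm::finite)^('n + 'm) \<Rightarrow> (nat \<Rightarrow> real^('n + 'm)^('n + 'm)) \<Rightarrow> nat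
   \<Rightarrow> real^(('n + 'm) uprod)^(('n + 'm) \<times> ('n + 'm)) \<Rightarrow> real^('n \<times> 'n)^('n uprod)
   \<Rightarrow> real^(('n + 'm) uprod) \<Rightarrow> (nat \<Rightarrow> real^('n uprod)) \<Rightarrow> real^(('n + 'm) uprod)" where
  "Lstar R F M D1 T2 X0 X =
     transpose D1 *v vec_mat R - X0
     + transpose D1 *v (\<Sum>i=1..M. transpose (Xi (F i)) *v (transpose T2 *v X i))"

definition Lstar_minus0 ::
  "real^('n::finite + 'm::finite)^('n + 'm) \<Rightarrow> (nat \<Rightarrow> real^('n + 'm)^('n + 'm)) \<Rightarrow> nat
   \<Rightarrow> real^(('n + 'm) uprod)^(('n + 'm) \<times> ('n + 'm)) \<Rightarrow> real^('n \<times> 'n)^('n uprod)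
   \<Rightarrow> real^(('n + 'm) uprod) \<Rightarrow> (nat \<Rightarrow> real^('n uprod)) \<Rightarrow> real^(('n + 'm) uprod)" where
  "Lstar_minus0 R F M D1 T2 X0 X = Lstar R F M D1 T2 X0 X + X0"

definition Lstar_minus ::
  "real^('n::finite + 'm::finite)^('n + 'm) \<Rightarrow> (nat \<Rightarrow> real^('n + 'm)^('n + 'm)) \<Rightarrow> nat
   \<Rightarrow> real^(('n + 'm) uprod)^(('n + 'm) \<times> ('n + 'm)) \<Rightarrow> real^('n \<times> 'n)^('n uprod)
   \<Rightarrow> nat \<Rightarrow> real^(('n + 'm) uprod) \<Rightarrow> (nat \<Rightarrow> real^('n uprod)) \<Rightarrow> real^(('n + 'm) uprod)" where
  "Lstar_minus R F M D1 T2 i X0 X =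
     Lstar R F M D1 T2 X0 X
     - transpose D1 *v (transpose (Xi (F i)) *v (transpose T2 *v X i))"

definition Omega ::
  "real^('n::finite + 'm::finite)^('n + 'm) \<Rightarrow> real^('n + 'm)^('n + 'm) \<Rightarrow> (nat \<Rightarrow> real^('n + 'm)^('n + 'm)) \<Rightarrow> nat
   \<Rightarrow> real^(('n + 'm) uprod)^(('n + 'm) \<times> ('n + 'm)) \<Rightarrow> real^('n \<times> 'n)^('n uprod)
   \<Rightarrow> real \<Rightarrow> real^(('n + 'm) \<times> ('n + 'm))
   \<Rightarrow> real^(('n + 'm) uprod) \<Rightarrow> (nat \<Rightarrow> real^('n uprod)) \<Rightarrow> ereal" where
  "Omega Q R F M D1 T2 \<beta> \<xi> X0 X =
     ereal (
       - ((\<Sum>i=1..M. X i) \<bullet> (T2 *v (kron V2 V2 *v vec_mat Q)))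
       - Lstar R F M D1 T2 X0 X \<bullet> (matrix_inv (transpose D1 ** D1) *v (transpose D1 *v \<xi>))
       + 1 / (2 * \<beta>) *
         (norm (psd_sqrt (matrix_inv (transpose D1 ** D1)) *v Lstar R F M D1 T2 X0 X))\<^sup>2)
     + indicator_ereal Gamma_plus X0
     + (\<Sum>i=1..M. indicator_ereal Gamma_plus (X i))"

definition L_mat0 ::
  "real^(('n::finite + 'm::finite) uprod)^(('n + 'm) \<times> ('n + 'm)) \<Rightarrow> real
   \<Rightarrow> real^(('n + 'm) uprod)^(('n + 'm) uprod)" where
  "L_mat0 D1 \<beta> = (1 / \<beta>) *\<^sub>R matrix_inv (transpose D1 ** D1)"

definition L_mat ::
  "(nat \<Rightarrow> real^('n::finite + 'm::finite)^('n + 'm))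
   \<Rightarrow> real^(('n + 'm) uprod)^(('n + 'm) \<times> ('n + 'm)) \<Rightarrow> real^('n \<times> 'n)^('n uprod)
   \<Rightarrow> real \<Rightarrow> nat \<Rightarrow> real^('n uprod)^('n uprod)" where
  "L_mat F D1 T2 \<beta> i =
     (1 / \<beta>) *\<^sub>R (T2 ** Xi (F i) ** D1 ** matrix_inv (transpose D1 ** D1)
                  ** transpose D1 ** transpose (Xi (F i)) ** transpose T2)"

definition H_vec0 ::
  "real^('n::finite + 'm::finite)^('n + 'm) \<Rightarrow> (nat \<Rightarrow> real^('n + 'm)^('n + 'm)) \<Rightarrow> nat
   \<Rightarrow> real^(('n + 'm) uprod)^(('n + 'm) \<times> ('n + 'm)) \<Rightarrow> real^('n \<times> 'n)^('n uprod)
   \<Rightarrow> real \<Rightarrow> real^(('n + 'm) \<times> ('n + 'm))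
   \<Rightarrow> real^(('n + 'm) uprod) \<Rightarrow> (nat \<Rightarrow> real^('n uprod)) \<Rightarrow> real^(('n + 'm) uprod)" where
  "H_vec0 R F M D1 T2 \<beta> \<xi> X0 X =
     - (matrix_inv (transpose D1 ** D1) *v (transpose D1 *v \<xi>))
     + (1 / \<beta>) *\<^sub>R (matrix_inv (transpose D1 ** D1) *v Lstar_minus0 R F M D1 T2 X0 X)"

definition H_vec ::
  "real^('n::finite + 'm::finite)^('n + 'm) \<Rightarrow> real^('n + 'm)^('n + 'm) \<Rightarrow> (nat \<Rightarrow> real^('n + 'm)^('n + 'm)) \<Rightarrow> nat
   \<Rightarrow> real^(('n + 'm) uprod)^(('n + 'm) \<times> ('n + 'm)) \<Rightarrow> real^('n \<times> 'n)^('n uprod)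
   \<Rightarrow> real \<Rightarrow> real^(('n + 'm) \<times> ('n + 'm)) \<Rightarrow> nat
   \<Rightarrow> real^(('n + 'm) uprod) \<Rightarrow> (nat \<Rightarrow> real^('n uprod)) \<Rightarrow> real^('n uprod)" where
  "H_vec Q R F M D1 T2 \<beta> \<xi> i X0 X =
     T2 *v (kron V2 V2 *v vec_mat Q)
     + (T2 ** Xi (F i) ** D1 ** matrix_inv (transpose D1 ** D1)) *v (transpose D1 *v \<xi>)
     - (1 / \<beta>) *\<^sub>R ((T2 ** Xi (F i) ** D1 ** matrix_inv (transpose D1 ** D1))
                     *v Lstar_minus R F M D1 T2 i X0 X)"

text \<open>One full sweep, in the order \<open>i = M, \<dots>, 1, 0\<close>: when block \<open>i\<close> is updated, the blocks with a
  larger index already carry the new values.  Block \<open>i\<close> itself does not enter \<open>H\<^sub>i\<close>, so its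
  value in the mixed block vector is irrelevant.\<close>

definition mixed :: "nat \<Rightarrow> (nat \<Rightarrow> 'a) \<Rightarrow> (nat \<Rightarrow> 'a) \<Rightarrow> nat \<Rightarrow> 'a" where
  "mixed i X Xnew = (\<lambda>j. if j \<le> i then X j else Xnew j)"

definition pbcd_sweep ::
  "real^('n::finite + 'm::finite)^('n + 'm) \<Rightarrow> real^('n + 'm)^('n + 'm) \<Rightarrow> (nat \<Rightarrow> real^('n + 'm)^('n + 'm)) \<Rightarrow> nat
   \<Rightarrow> real^(('n + 'm) uprod)^(('n + 'm) \<times> ('n + 'm)) \<Rightarrow> real^('n \<times> 'n)^('n uprod)
   \<Rightarrow> real \<Rightarrow> real^(('n + 'm) \<times> ('n + 'm))
   \<Rightarrow> real^(('n + 'm) uprod) \<Rightarrow> (nat \<Rightarrow> real^('n uprod))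
   \<Rightarrow> real^(('n + 'm) uprod) \<Rightarrow> (nat \<Rightarrow> real^('n uprod)) \<Rightarrow> bool" where
  "pbcd_sweep Q R F M D1 T2 \<beta> \<xi> X0 X X0new Xnew \<longleftrightarrow>
     (\<forall>i\<in>{1..M}.
        let Li = L_mat F D1 T2 \<beta> i; \<rho> = max_eigenvalue Li in
        Xnew i = closest_point Gamma_plus
          (inverse \<rho> *\<^sub>R (H_vec Q R F M D1 T2 \<beta> \<xi> i X0 (mixed i X Xnew)
                         + \<rho> *\<^sub>R X i - Li *v X i)))
     \<and> (let L0 = L_mat0 D1 \<beta>; \<rho> = max_eigenvalue L0 in
        X0new = closest_point Gamma_plus
          (inverse \<rho> *\<^sub>R (H_vec0 R F M D1 T2 \<beta> \<xi> X0 Xnew + \<rho> *\<^sub>R X0 - L0 *v X0)))"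

end

theory Submission
  imports Defs
begin

text \<open>
  Up to the indicator functions, \<open>\<Omega>\<close> is a convex quadratic of the affine expression
  \<open>\<L>\<^sup>\<star>(X)\<close> plus a linear term.  Its partial gradient with respect to \<open>X\<^sub>i\<close> is
  \<open>L\<^sub>i X\<^sub>i - H\<^sub>i\<close>, so that every update is a projected gradient step whose length is the
  reciprocal of the Lipschitz constant \<open>\<rho>\<^sub>i\<close> of this partial gradient.  Two estimates give the rate.
  A sweep with increments \<open>d\<^sub>i\<close> decreases \<open>\<Omega>\<close> by at least \<open>\<Sum>i. \<rho>\<^sub>i \<parallel>d\<^sub>i\<parallel>\<^sup>2 / 2\<close>
  (\<open>sweep_decrease\<close>).  On the other hand, convexity and the optimality conditions of the
  projections bound the gap after the sweep by a multiple of \<open>\<parallel>d\<parallel>\<close> times the distance to the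
  comparison point (\<open>sweep_gap\<close>).  If these distances are bounded, then the gaps \<open>e k\<close> satisfy
  \<open>\<gamma> (e (k + 1))\<^sup>2 \<le> e k - e (k + 1)\<close>, hence \<open>e k = O(1/k)\<close> (\<open>quadratic_decrease_rate\<close>).

  Boundedness comes from the strictly feasible \<open>W\<close>.  The quadratic lies above its tangent with
  gradient \<open>- svec W\<close>, which bounds \<open>\<Omega>\<close> from below by
  \<open>\<langle>X\<^sub>0, svec W\<rangle> + (\<Sum>i. \<langle>X\<^sub>i, svec (\<Upsilon>\<^sub>i W)\<rangle>)\<close> up to a constant (\<open>objective_coercive\<close>).  The
  inner product of unscaled \<open>svec\<close> vectors is the mean of the trace inner product and of the inner
  product of the diagonals, so a positive definite matrix still lies in the interior of the dual
  cone (\<open>posdef_inner_Gamma_plus\<close>), and the sublevel sets are bounded.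

  The step lengths make sense because \<open>\<rho>\<^sub>i > 0\<close>: if \<open>L\<^sub>i\<close> vanished, then \<open>\<Upsilon>\<^sub>i W\<close> would be equal to
  \<open>- B\<^sub>1 B\<^sub>1\<^sup>T\<close>, which is negative definite.  The eigenvalue \<open>\<rho>\<^sub>i\<close> is the maximum of a Rayleigh
  quotient (\<open>Rayleigh_le_max_eigenvalue\<close>).  The same variational argument gives uniqueness of
  positive semidefinite square roots; existence for \<open>(D\<^sub>1\<^sup>T D\<^sub>1)\<^sup>-\<^sup>1\<close> is explicit, since \<open>D\<^sub>1\<^sup>T D\<^sub>1\<close> is
  diagonal.
\<close>

(* The transpose is kept in front of the vector, so that adjoints stay recognisable. *)
declare transpose_matrix_vector [simp del]

section \<open>A recursion that forces the rate \<open>1 / k\<close>\<close>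

text \<open>The induction step: if \<open>e (Suc k)\<close> exceeded \<open>c / (k + 1)\<close> with \<open>\<gamma> c \<ge> 2\<close>, then
  \<open>e k \<ge> e (Suc k) + \<gamma> (e (Suc k))\<^sup>2\<close> would exceed \<open>c / k\<close>, because \<open>2 / (k + 1) \<ge> 1 / k\<close>.\<close>

lemma quadratic_decrease_rate:
  fixes e :: "nat \<Rightarrow> real"
  assumes \<gamma>: "\<gamma> > 0"
    and dec: "\<And>k. k \<ge> 1 \<Longrightarrow> \<gamma> * (e (Suc k))\<^sup>2 \<le> e k - e (Suc k)"
    and k: "k \<ge> 1"
  shows "e k \<le> max (e 1) (2 / \<gamma>) / real k"
  using k
proof (induction k rule: dec_induct)
  case base
  then show ?case by simp
next
  case (step k)
  define c where "c = max (e 1) (2 / \<gamma>)"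
  have kpos: "real k \<ge> 1" using step(1) by simp
  have c: "c \<ge> 2 / \<gamma>" by (simp add: c_def)
  have cpos: "c > 0" using \<gamma> c by (meson divide_pos_pos less_le_trans zero_less_numeral)
  have gc: "\<gamma> * c \<ge> 2" using c \<gamma> by (simp add: field_simps)
  show ?case
    unfolding c_def [symmetric]
  proof (rule ccontr)
    assume "\<not> e (Suc k) \<le> c / real (Suc k)"
    then have gt: "e (Suc k) > c / (real k + 1)" by (simp add: add.commute)
    have pos: "c / (real k + 1) > 0" using cpos by (simp add: divide_pos_pos)
    have "(c / (real k + 1))\<^sup>2 \<le> (e (Suc k))\<^sup>2"
      using gt pos by (intro power_mono) auto
    then have "e k > c / (real k + 1) + \<gamma> * (c / (real k + 1))\<^sup>2"
      using gt dec [OF step(1)] \<gamma> by (smt (verit) mult_left_mono)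
    moreover have "e k \<le> c / real k" using step(3) by (simp add: c_def)
    ultimately have lt: "c / (real k + 1) + \<gamma> * (c / (real k + 1))\<^sup>2 < c / real k" by linarith
    have "\<gamma> * (c / (real k + 1))\<^sup>2 = (\<gamma> * c) * c / (real k + 1)\<^sup>2"
      by (simp add: power2_eq_square)
    also have "\<dots> \<ge> 2 * c / (real k + 1)\<^sup>2"
      using gc cpos by (intro divide_right_mono mult_right_mono) auto
    finally have "\<gamma> * (c / (real k + 1))\<^sup>2 \<ge> 2 * c / (real k + 1)\<^sup>2" .
    moreover have "2 * c / (real k + 1)\<^sup>2 \<ge> c / real k - c / (real k + 1)"
    proof -
      have "c / real k - c / (real k + 1) = c / (real k * (real k + 1))"
        using kpos by (simp add: field_simps)
      also have "\<dots> \<le> c / ((real k + 1) / 2 * (real k + 1))"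
        using kpos cpos by (intro divide_left_mono mult_right_mono mult_pos_pos) auto
      also have "\<dots> = 2 * c / (real k + 1)\<^sup>2"
        by (simp add: power2_eq_square)
      finally show ?thesis .
    qed
    ultimately show False using lt by linarith
  qed
qed

section \<open>Symmetric matrices\<close>

lemma inner_matrix_transpose:
  fixes A :: "real^'j^'i"
  shows "x \<bullet> (A *v y) = (transpose A *v x) \<bullet> y"
  by (simp add: dot_lmul_matrix transpose_matrix_vector)

lemma sym_mat_inner:
  "sym_mat S \<Longrightarrow> x \<bullet> (S *v y) = (S *v x) \<bullet> y"
  by (simp add: inner_matrix_transpose sym_mat_def)

lemma sym_mat_entry: "sym_mat S \<Longrightarrow> S $ i $ j = S $ j $ i"
  by (simp add: sym_mat_def transpose_def vec_eq_iff)

lemma inner_axis_matrix: "axis i 1 \<bullet> (S *v axis j 1) = (S::real^'k^'k) $ i $ j"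
  by (simp add: matrix_vector_mult_basis inner_axis' column_def)

lemma psd_Cauchy_Schwarz:
  assumes "psd S"
  shows "(x \<bullet> (S *v y))\<^sup>2 \<le> (x \<bullet> (S *v x)) * (y \<bullet> (S *v y))"
proof -
  define \<alpha> \<beta> \<gamma> where "\<alpha> = x \<bullet> (S *v x)" and "\<beta> = x \<bullet> (S *v y)" and "\<gamma> = y \<bullet> (S *v y)"
  have sym: "y \<bullet> (S *v x) = \<beta>"
    using assms sym_mat_inner [of S x y] by (simp add: \<beta>_def psd_def inner_commute)
  have quad: "0 \<le> \<alpha> + 2 * t * \<beta> + t\<^sup>2 * \<gamma>" for t
  proof -
    have "0 \<le> (x + t *\<^sub>R y) \<bullet> (S *v (x + t *\<^sub>R y))"
      using assms by (simp add: psd_def)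
    also have "\<dots> = \<alpha> + 2 * t * \<beta> + t\<^sup>2 * \<gamma>"
      using sym by (simp add: \<alpha>_def \<beta>_def \<gamma>_def matrix_vector_right_distrib
          matrix_vector_mult_scaleR inner_add_left inner_add_right power2_eq_square algebra_simps)
    finally show ?thesis .
  qed
  have "\<gamma> \<ge> 0" using assms by (simp add: \<gamma>_def psd_def)
  then consider "\<gamma> > 0" | "\<gamma> = 0" by linarith
  then have "\<beta>\<^sup>2 \<le> \<alpha> * \<gamma>"
  proof cases
    case 1
    have "0 \<le> \<alpha> + 2 * (- \<beta> / \<gamma>) * \<beta> + (- \<beta> / \<gamma>)\<^sup>2 * \<gamma>" by (rule quad)
    also have "\<dots> = \<alpha> - \<beta>\<^sup>2 / \<gamma>" using 1 by (simp add: power2_eq_square field_simps)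
    finally show ?thesis using 1 by (simp add: field_simps)
  next
    case 2
    have "\<beta> = 0"
    proof (rule ccontr)
      assume "\<beta> \<noteq> 0"
      then show False using quad [of "- (\<alpha> + 1) / (2 * \<beta>)"] 2 by (simp add: field_simps)
    qed
    then show ?thesis using 2 by simp
  qed
  then show ?thesis by (simp add: \<alpha>_def \<beta>_def \<gamma>_def)
qed

lemma psd_form_zeroD:
  assumes "psd S" "v \<bullet> (S *v v) = 0"
  shows "S *v v = 0"
proof -
  have "((S *v v) \<bullet> (S *v v))\<^sup>2 \<le> 0"
    using psd_Cauchy_Schwarz [OF assms(1), of "S *v v" v] assms(2) by simp
  then show ?thesis by simp
qed

text \<open>The Rayleigh quotient attains its maximum on the compact unit sphere.  At a maximiser \<open>v\<close>
  with value \<open>c\<close>, the matrix \<open>c I - S\<close> is positive semidefinite with \<open>v\<close> a null vector of its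
  form, which makes \<open>v\<close> an eigenvector.\<close>

lemma Rayleigh_maximiser:
  fixes S :: "real^'k^'k"
  assumes "sym_mat S"
  obtains c v where "eigenpair S c v" "\<And>x. x \<bullet> (S *v x) \<le> c * (x \<bullet> x)"
proof -
  have "continuous_on (sphere 0 1) (\<lambda>x::real^'k. x \<bullet> (S *v x))"
    by (intro continuous_intros)
  moreover have "sphere (0::real^'k) 1 \<noteq> {}" by simp
  ultimately obtain v where v: "v \<in> sphere 0 1"
    and max: "\<And>x. x \<in> sphere 0 1 \<Longrightarrow> x \<bullet> (S *v x) \<le> v \<bullet> (S *v v)"
    using continuous_attains_sup [OF compact_sphere, of 0 1 "\<lambda>x::real^'k. x \<bullet> (S *v x)"] by auto
  define c where "c = v \<bullet> (S *v v)"
  have le: "x \<bullet> (S *v x) \<le> c * (x \<bullet> x)" for x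
  proof (cases "x = 0")
    case False
    have "(inverse (norm x) *\<^sub>R x) \<bullet> (S *v (inverse (norm x) *\<^sub>R x)) \<le> c"
      unfolding c_def using False by (intro max) simp
    then have "(inverse (norm x))\<^sup>2 * (x \<bullet> (S *v x)) \<le> c"
      by (simp add: matrix_vector_mult_scaleR power2_eq_square)
    then show ?thesis
      using False by (simp add: dot_square_norm field_simps)
  qed simp
  define T where "T = c *\<^sub>R mat 1 - S"
  have T: "T *v x = c *\<^sub>R x - S *v x" for x
    by (simp add: T_def matrix_vector_mult_diff_rdistrib scaleR_matrix_vector_assoc [symmetric])
  have "sym_mat T"
    using assms by (auto simp: T_def sym_mat_def transpose_def vec_eq_iff mat_def)
  then have "psd T"
    using le by (simp add: psd_def T inner_diff_right)
  moreover have "v \<bullet> (T *v v) = 0"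
    using v by (simp add: T inner_diff_right c_def dot_square_norm)
  ultimately have "T *v v = 0" by (rule psd_form_zeroD)
  then have "eigenpair S c v"
    using v by (auto simp: eigenpair_def T scalar_mult_eq_scaleR)
  then show ?thesis using le that by blast
qed

lemma Rayleigh_le_max_eigenvalue:
  fixes S :: "real^'k^'k"
  assumes "sym_mat S"
  shows "x \<bullet> (S *v x) \<le> max_eigenvalue S * (x \<bullet> x)"
proof -
  obtain c v where cv: "eigenpair S c v" and le: "\<And>x. x \<bullet> (S *v x) \<le> c * (x \<bullet> x)"
    using Rayleigh_maximiser [OF assms] by blast
  have "max_eigenvalue S = c"
    unfolding max_eigenvalue_def
  proof (rule Greatest_equality)
    fix d assume "\<exists>w. eigenpair S d w"
    then obtain w where w: "w \<noteq> 0" "S *v w = d *\<^sub>R w"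
      by (auto simp: eigenpair_def scalar_mult_eq_scaleR)
    have "d * (w \<bullet> w) \<le> c * (w \<bullet> w)" using le [of w] w by simp
    then show "d \<le> c" using w(1) by simp
  qed (use cv in blast)
  then show ?thesis using le by simp
qed

lemma max_eigenvalue_pos:
  fixes S :: "real^'k^'k"
  assumes "sym_mat S" "0 < x \<bullet> (S *v x)"
  shows "0 < max_eigenvalue S"
proof -
  have "0 < max_eigenvalue S * (x \<bullet> x)"
    using Rayleigh_le_max_eigenvalue [OF assms(1), of x] assms(2) by linarith
  then show ?thesis by (metis inner_ge_zero zero_less_mult_pos2 mult_eq_0_iff less_le)
qed

lemma posdef_lower_bound:
  fixes W :: "real^'k^'k"
  assumes "posdef W"
  obtains c where "c > 0" "\<And>x. c * (x \<bullet> x) \<le> x \<bullet> (W *v x)"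
proof -
  have neg: "(- W) *v x = - (W *v x)" for x
    by (metis diff_0 matrix_vector_mult_0 matrix_vector_mult_diff_rdistrib)
  have "sym_mat (- W)"
    using assms by (simp add: posdef_def sym_mat_def transpose_def vec_eq_iff)
  then obtain d v where dv: "eigenpair (- W) d v"
    and le: "\<And>x. x \<bullet> ((- W) *v x) \<le> d * (x \<bullet> x)"
    using Rayleigh_maximiser by blast
  have v: "v \<noteq> 0" "W *v v = (- d) *\<^sub>R v"
    using dv by (auto simp: eigenpair_def scalar_mult_eq_scaleR neg) (metis minus_minus)
  have "0 < v \<bullet> (W *v v)" using assms v(1) by (simp add: posdef_def)
  then have "- d * (v \<bullet> v) > 0" using v by simp
  then have "- d > 0" using v(1) by (metis inner_gt_zero_iff zero_less_mult_pos2)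
  then show ?thesis
    using that [of "- d"] le by (simp add: neg minus_le_iff)
qed

text \<open>If \<open>P\<^sup>2 = P'\<^sup>2\<close>, then \<open>P v\<close> and \<open>P' v\<close> have the same norm, so \<open>(P - P') v\<close> is orthogonal to
  \<open>(P + P') v\<close>.  For an eigenvector \<open>v\<close> of \<open>P - P'\<close> with nonzero eigenvalue, both forms then
  vanish at \<open>v\<close>, hence \<open>P v = P' v = 0\<close>, a contradiction.  The largest eigenvalue of \<open>P - P'\<close> is
  therefore 0.\<close>

lemma psd_square_diff_form_nonpos:
  fixes P P' :: "real^'k^'k"
  assumes P: "psd P" and P': "psd P'" and eq: "P ** P = P' ** P'"
  shows "x \<bullet> ((P - P') *v x) \<le> 0"
proof -
  have "sym_mat (P - P')"
    using P P' by (simp add: psd_def sym_mat_def transpose_def vec_eq_iff)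
  then obtain c v where cv: "eigenpair (P - P') c v"
    and le: "\<And>x. x \<bullet> ((P - P') *v x) \<le> c * (x \<bullet> x)"
    using Rayleigh_maximiser by blast
  have v: "v \<noteq> 0" "P *v v - P' *v v = c *\<^sub>R v"
    using cv by (auto simp: eigenpair_def scalar_mult_eq_scaleR matrix_vector_mult_diff_rdistrib)
  have "(P *v v) \<bullet> (P *v v) = v \<bullet> ((P ** P) *v v)"
    using P sym_mat_inner [of P v "P *v v"] by (simp add: psd_def matrix_vector_mul_assoc [symmetric])
  also have "\<dots> = (P' *v v) \<bullet> (P' *v v)"
    using P' sym_mat_inner [of P' v "P' *v v"]
    by (simp add: eq psd_def matrix_vector_mul_assoc [symmetric])
  finally have "0 = (P *v v - P' *v v) \<bullet> (P *v v + P' *v v)"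
    by (simp add: inner_diff_left inner_add_right inner_commute [of "P' *v v" "P *v v"])
  then have zero: "c * (v \<bullet> (P *v v) + v \<bullet> (P' *v v)) = 0"
    unfolding v(2) inner_scaleR_left inner_add_right [symmetric] by (rule sym)
  have "c = 0"
  proof (rule ccontr)
    assume "c \<noteq> 0"
    then have "v \<bullet> (P *v v) + v \<bullet> (P' *v v) = 0" using zero by (simp only: mult_eq_0_iff) simp
    moreover have "v \<bullet> (P *v v) \<ge> 0" "v \<bullet> (P' *v v) \<ge> 0" using P P' by (auto simp: psd_def)
    ultimately have "P *v v = 0" "P' *v v = 0"
      using P P' by (auto intro!: psd_form_zeroD)
    then show False using v \<open>c \<noteq> 0\<close> by simp
  qed
  then show ?thesis using le by simp
qed

lemma psd_square_unique:
  fixes P P' :: "real^'k^'k"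
  assumes P: "psd P" and P': "psd P'" and eq: "P ** P = P' ** P'"
  shows "P = P'"
proof -
  have zero: "x \<bullet> ((P - P') *v x) = 0" for x
    using psd_square_diff_form_nonpos [OF assms, of x]
      psd_square_diff_form_nonpos [OF P' P eq [symmetric], of x]
    by (simp add: matrix_vector_mult_diff_rdistrib inner_diff_right)
  have "sym_mat (P - P')"
    using P P' by (simp add: psd_def sym_mat_def transpose_def vec_eq_iff)
  then have "psd (P - P')" by (simp add: psd_def zero)
  then have "(P - P') *v x = 0" for x using zero by (rule psd_form_zeroD)
  then have "P *v x = P' *v x" for x by (simp add: matrix_vector_mult_diff_rdistrib)
  then show ?thesis by (simp add: matrix_eq)
qed

lemma norm_psd_sqrt:
  fixes P :: "real^'k^'k"
  assumes "psd P" "P ** P = S"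
  shows "(norm (psd_sqrt S *v x))\<^sup>2 = x \<bullet> (S *v x)"
proof -
  have "psd_sqrt S = P"
    unfolding psd_sqrt_def using assms by (intro the_equality) (auto intro: psd_square_unique)
  moreover have "S *v x = P *v (P *v x)"
    by (simp add: assms(2) matrix_vector_mul_assoc)
  ultimately show ?thesis
    using assms(1) sym_mat_inner [of P x "P *v x"] by (simp add: power2_norm_eq_inner psd_def)
qed

lemma psd_diagonal_nonneg: "psd S \<Longrightarrow> 0 \<le> S $ i $ i"
  by (metis inner_axis_matrix psd_def)

lemma psd_entry_bound:
  fixes S :: "real^'k^'k"
  assumes "psd S"
  shows "(S $ i $ j)\<^sup>2 \<le> S $ i $ i * S $ j $ j"
  using psd_Cauchy_Schwarz [OF assms, of "axis i 1" "axis j 1"] by (simp add: inner_axis_matrix)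

text \<open>The trace inner product of positive semidefinite matrices is nonnegative.  A nonzero
  diagonal entry \<open>S\<^sub>k\<^sub>k\<close> allows the rank-one matrix \<open>u u\<^sup>T / S\<^sub>k\<^sub>k\<close>, \<open>u\<close> the \<open>k\<close>-th column of \<open>S\<close>,
  to be split off: the rest is again positive semidefinite, with fewer nonzero diagonal entries.\<close>

lemma sum_entries_psd_nonneg:
  fixes S T :: "real^'k^'k"
  assumes "psd S" "psd T"
  shows "0 \<le> (\<Sum>i\<in>UNIV. \<Sum>j\<in>UNIV. S $ i $ j * T $ i $ j)"
  using assms(1)
proof (induction "card {k. S $ k $ k \<noteq> 0}" arbitrary: S rule: less_induct)
  case (less S)
  show ?case
  proof (cases "\<exists>k. S $ k $ k \<noteq> 0")
    case False
    then have "S $ i $ j = 0" for i j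
      using psd_entry_bound [OF less.prems, of i j] by simp
    then show ?thesis by simp
  next
    case True
    then obtain k where k: "S $ k $ k \<noteq> 0" by blast
    define s where "s = S $ k $ k"
    define u where "u = S *v axis k 1"
    have s: "s > 0" using k psd_diagonal_nonneg [OF less.prems, of k] by (simp add: s_def)
    have u: "u $ i = S $ i $ k" for i
      by (simp add: u_def matrix_vector_mult_basis column_def)
    define S' where "S' = (\<chi> i j. S $ i $ j - u $ i * u $ j / s)"
    have S'x: "S' *v x = S *v x - ((u \<bullet> x) / s) *\<^sub>R u" for x
      by (simp add: vec_eq_iff S'_def matrix_vector_mult_def inner_vec_def sum_subtractf
          left_diff_distrib right_diff_distrib sum_divide_distrib sum_distrib_right
          sum_distrib_left mult_ac)
    have sym: "sym_mat S" using less.prems by (simp add: psd_def)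
    have "sym_mat S'"
      using sym_mat_entry [OF sym] by (simp add: sym_mat_def transpose_def vec_eq_iff S'_def mult.commute)
    moreover have "0 \<le> x \<bullet> (S' *v x)" for x
    proof -
      have "(u \<bullet> x)\<^sup>2 \<le> (x \<bullet> (S *v x)) * s"
        using psd_Cauchy_Schwarz [OF less.prems, of x "axis k 1"]
        by (simp add: u_def s_def inner_axis_matrix inner_commute)
      then show ?thesis
        using s by (simp add: S'x inner_diff_right inner_commute power2_eq_square field_simps)
    qed
    ultimately have psd': "psd S'" by (simp add: psd_def)
    have "{i. S' $ i $ i \<noteq> 0} \<subset> {i. S $ i $ i \<noteq> 0}"
    proof
      show "{i. S' $ i $ i \<noteq> 0} \<subseteq> {i. S $ i $ i \<noteq> 0}"
      proof (intro subsetI CollectI notI)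
        fix i assume i: "i \<in> {i. S' $ i $ i \<noteq> 0}" and z: "S $ i $ i = 0"
        have "u $ i = 0" using psd_entry_bound [OF less.prems, of i k] z by (simp add: u)
        then show False using i z by (simp add: S'_def)
      qed
      have "S' $ k $ k = 0" using s by (simp add: S'_def u s_def)
      then show "{i. S' $ i $ i \<noteq> 0} \<noteq> {i. S $ i $ i \<noteq> 0}" using k by blast
    qed
    then have "card {i. S' $ i $ i \<noteq> 0} < card {i. S $ i $ i \<noteq> 0}"
      by (intro psubset_card_mono) auto
    then have IH: "0 \<le> (\<Sum>i\<in>UNIV. \<Sum>j\<in>UNIV. S' $ i $ j * T $ i $ j)"
      using less.hyps psd' by blast
    have "(\<Sum>i\<in>UNIV. \<Sum>j\<in>UNIV. S $ i $ j * T $ i $ j) =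
        (\<Sum>i\<in>UNIV. \<Sum>j\<in>UNIV. S' $ i $ j * T $ i $ j) + (\<Sum>i\<in>UNIV. \<Sum>j\<in>UNIV. u $ i * u $ j / s * T $ i $ j)"
      by (simp add: S'_def left_diff_distrib sum_subtractf)
    also have "(\<Sum>i\<in>UNIV. \<Sum>j\<in>UNIV. u $ i * u $ j / s * T $ i $ j) = (u \<bullet> (T *v u)) / s"
      by (simp add: inner_vec_def matrix_vector_mult_def sum_distrib_left sum_divide_distrib mult_ac)
    finally show ?thesis
      using IH s assms(2) by (simp add: psd_def)
  qed
qed

section \<open>The cone of vectorised positive semidefinite matrices\<close>

text \<open>The inverse of \<^const>\<open>svec\<close> on symmetric matrices.\<close>

definition smat :: "real^('k uprod) \<Rightarrow> real^'k^'k" where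
  "smat v = (\<chi> i j. v $ Upair i j)"

lemma smat_entry [simp]: "smat v $ i $ j = v $ Upair i j"
  by (simp add: smat_def)

lemma sym_mat_smat: "sym_mat (smat v)"
  by (auto simp: sym_mat_def transpose_def smat_def vec_eq_iff intro!: arg_cong [of _ _ "($) v"])

lemma svec_smat: "svec (smat v) = v"
  unfolding vec_eq_iff
proof
  fix u :: "'a uprod"
  show "svec (smat v) $ u = v $ u"
    by (cases u) (simp add: svec_Upair [OF sym_mat_smat])
qed

lemma smat_svec: "sym_mat S \<Longrightarrow> smat (svec S) = S"
  by (simp add: vec_eq_iff svec_Upair)

lemma linear_smat: "linear smat"
  by (rule linearI) (simp_all add: smat_def vec_eq_iff)

lemma Gamma_plus_iff: "v \<in> Gamma_plus \<longleftrightarrow> psd (smat v)"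
proof
  assume "v \<in> Gamma_plus"
  then obtain S where "v = svec S" "psd S" by (auto simp: Gamma_plus_def)
  then show "psd (smat v)" by (simp add: smat_svec psd_def)
next
  assume "psd (smat v)"
  moreover have "v = svec (smat v)" by (simp add: svec_smat)
  ultimately show "v \<in> Gamma_plus" unfolding Gamma_plus_def by blast
qed

lemma linear_smat_form: "linear (\<lambda>v. x \<bullet> (smat v *v x))"
  by (rule linearI)
    (simp_all add: linear_add [OF linear_smat] linear_scale [OF linear_smat] inner_add_right
      matrix_vector_mult_add_rdistrib scaleR_matrix_vector_assoc [symmetric])

lemma Gamma_plus_eq: "Gamma_plus = (\<Inter>x. {v. 0 \<le> x \<bullet> (smat v *v x)})"
  by (auto simp: Gamma_plus_iff psd_def sym_mat_smat)

lemma closed_Gamma_plus: "closed (Gamma_plus :: (real^('k::finite uprod)) set)"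
proof -
  have "closed {v. 0 \<le> x \<bullet> (smat v *v x)}" for x :: "real^'k"
    using linear_continuous_on [OF linear_conv_bounded_linear [THEN iffD1, OF linear_smat_form]]
    by (intro closed_Collect_le continuous_on_const)
  then show ?thesis unfolding Gamma_plus_eq by blast
qed

lemma convex_Gamma_plus: "convex (Gamma_plus :: (real^('k::finite uprod)) set)"
  unfolding convex_def Gamma_plus_eq
  by (auto simp: linear_add [OF linear_smat_form] linear_scale [OF linear_smat_form])

lemma zero_in_Gamma_plus: "0 \<in> Gamma_plus"
  by (simp add: Gamma_plus_eq linear_0 [OF linear_smat_form])

lemma card_Upair_fibre:
  "card {ij. Upair (fst ij) (snd ij) = (u :: 'k::finite uprod)} + card {i. Upair i i = u} = 2"
proof (cases u)
  case (Upair a b)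
  have "{ij. Upair (fst ij) (snd ij) = u} = {(a, b), (b, a)}"
    by (auto simp: Upair)
  moreover have "{i. Upair i i = u} = (if a = b then {a} else {})"
    by (auto simp: Upair)
  ultimately show ?thesis by auto
qed

text \<open>An unordered pair of distinct indices comes from two ordered pairs, a diagonal one from a
  single ordered pair.  The unscaled inner product of \<^const>\<open>svec\<close> is thus the mean of the
  trace inner product and of the inner product of the diagonals.\<close>

lemma inner_svec:
  fixes v w :: "real^('k::finite uprod)"
  shows "2 * (v \<bullet> w) = (\<Sum>i\<in>UNIV. \<Sum>j\<in>UNIV. smat v $ i $ j * smat w $ i $ j)
    + (\<Sum>i\<in>UNIV. smat v $ i $ i * smat w $ i $ i)"
proof -
  define f where "f u = v $ u * w $ u" for u
  have 1: "(\<Sum>i\<in>UNIV. \<Sum>j\<in>UNIV. f (Upair i j)) =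
      (\<Sum>u\<in>UNIV. of_nat (card {ij. Upair (fst ij) (snd ij) = u}) * f u)"
  proof -
    have "(\<Sum>i\<in>UNIV. \<Sum>j\<in>UNIV. f (Upair i j)) = (\<Sum>ij\<in>UNIV. f (Upair (fst ij) (snd ij)))"
      by (simp add: sum.cartesian_product UNIV_Times_UNIV split_beta)
    also have "\<dots> = (\<Sum>u\<in>UNIV. \<Sum>ij\<in>{ij\<in>UNIV. Upair (fst ij) (snd ij) = u}. f (Upair (fst ij) (snd ij)))"
      by (rule sum.group [symmetric]) auto
    also have "\<dots> = (\<Sum>u\<in>UNIV. of_nat (card {ij. Upair (fst ij) (snd ij) = u}) * f u)"
      by (intro sum.cong refl) simp
    finally show ?thesis .
  qed
  have 2: "(\<Sum>i\<in>UNIV. f (Upair i i)) = (\<Sum>u\<in>UNIV. of_nat (card {i. Upair i i = u}) * f u)"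
  proof -
    have "(\<Sum>i\<in>UNIV. f (Upair i i)) = (\<Sum>u\<in>UNIV. \<Sum>i\<in>{i\<in>UNIV. Upair i i = u}. f (Upair i i))"
      by (rule sum.group [symmetric]) auto
    also have "\<dots> = (\<Sum>u\<in>UNIV. of_nat (card {i. Upair i i = u}) * f u)"
      by (intro sum.cong refl) simp
    finally show ?thesis .
  qed
  have "(\<Sum>i\<in>UNIV. \<Sum>j\<in>UNIV. f (Upair i j)) + (\<Sum>i\<in>UNIV. f (Upair i i)) =
      (\<Sum>u\<in>UNIV. of_nat (card {ij. Upair (fst ij) (snd ij) = u} + card {i. Upair i i = u}) * f u)"
    by (simp only: 1 2 of_nat_add distrib_right sum.distrib)
  also have "\<dots> = 2 * (v \<bullet> w)"
    by (simp only: card_Upair_fibre) (simp add: f_def inner_vec_def sum_distrib_left)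
  finally show ?thesis by (simp add: f_def)
qed

lemma Gamma_plus_norm_le_trace:
  fixes v :: "real^('k::finite uprod)"
  assumes "v \<in> Gamma_plus"
  shows "norm v \<le> real CARD('k uprod) * (\<Sum>i\<in>UNIV. smat v $ i $ i)"
proof -
  have psd: "psd (smat v)" using assms by (simp add: Gamma_plus_iff)
  let ?tr = "\<Sum>i\<in>UNIV. smat v $ i $ i"
  have diag: "0 \<le> smat v $ i $ i" for i using psd by (rule psd_diagonal_nonneg)
  have le_tr: "smat v $ i $ i \<le> ?tr" for i
    by (rule member_le_sum) (use diag in auto)
  have "\<bar>v $ u\<bar> \<le> ?tr" for u
  proof (cases u)
    case (Upair i j)
    have "(smat v $ i $ j)\<^sup>2 \<le> smat v $ i $ i * smat v $ j $ j"
      using psd by (rule psd_entry_bound)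
    also have "\<dots> \<le> ?tr * ?tr"
      using le_tr diag order.trans [OF diag le_tr] by (intro mult_mono) auto
    finally have "\<bar>smat v $ i $ j\<bar>\<^sup>2 \<le> ?tr\<^sup>2" by (simp add: power2_eq_square)
    then have "\<bar>smat v $ i $ j\<bar> \<le> ?tr"
      by (rule power2_le_imp_le) (use diag in \<open>auto intro: sum_nonneg\<close>)
    then show ?thesis by (simp add: Upair)
  qed
  then have "(\<Sum>u\<in>UNIV. \<bar>v $ u\<bar>) \<le> (\<Sum>u\<in>(UNIV::'k uprod set). ?tr)" by (rule sum_mono)
  then show ?thesis using norm_le_l1_cart [of v] by simp
qed

text \<open>A positive definite matrix lies in the interior of the dual cone, also for the unscaled
  inner product.\<close>

lemma posdef_inner_Gamma_plus:
  fixes w :: "real^('k::finite uprod)"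
  assumes "posdef (smat w)"
  obtains c where "c > 0" "\<And>v. v \<in> Gamma_plus \<Longrightarrow> c * norm v \<le> v \<bullet> w"
proof -
  obtain d where d: "d > 0" and le: "\<And>x. d * (x \<bullet> x) \<le> x \<bullet> (smat w *v x)"
    using posdef_lower_bound [OF assms] by blast
  define T where "T = smat w - d *\<^sub>R mat 1"
  have "sym_mat T"
    using sym_mat_entry [OF sym_mat_smat, of w]
    by (auto simp: T_def sym_mat_def transpose_def vec_eq_iff mat_def)
  then have "psd T"
    using le by (simp add: T_def psd_def inner_diff_right matrix_vector_mult_diff_rdistrib
        scaleR_matrix_vector_assoc [symmetric])
  define N where "N = real CARD('k uprod)"
  have N: "N > 0" by (simp add: N_def)
  show ?thesis
  proof
    show "d / (2 * N) > 0" using d N by simp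
    fix v :: "real^('k uprod)" assume v: "v \<in> Gamma_plus"
    then have psd: "psd (smat v)" by (simp add: Gamma_plus_iff)
    have "0 \<le> (\<Sum>i\<in>UNIV. \<Sum>j\<in>UNIV. smat v $ i $ j * T $ i $ j)"
      using psd \<open>psd T\<close> by (rule sum_entries_psd_nonneg)
    also have "\<dots> = (\<Sum>i\<in>UNIV. \<Sum>j\<in>UNIV. smat v $ i $ j * smat w $ i $ j) - d * (\<Sum>i\<in>UNIV. smat v $ i $ i)"
    proof -
      have "smat v $ i $ j * T $ i $ j =
          smat v $ i $ j * smat w $ i $ j - (if j = i then d * smat v $ i $ i else 0)" for i j
        by (simp add: T_def mat_def algebra_simps)
      then show ?thesis by (simp add: sum_subtractf sum_distrib_left)
    qed
    finally have "d * (\<Sum>i\<in>UNIV. smat v $ i $ i) \<le> (\<Sum>i\<in>UNIV. \<Sum>j\<in>UNIV. smat v $ i $ j * smat w $ i $ j)"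
      by simp
    moreover have "0 \<le> (\<Sum>i\<in>UNIV. smat v $ i $ i * smat w $ i $ i)"
    proof (intro sum_nonneg mult_nonneg_nonneg)
      fix i
      show "0 \<le> smat v $ i $ i" using psd by (rule psd_diagonal_nonneg)
      have "psd (smat w)"
        using assms by (auto simp: psd_def posdef_def) (metis inner_zero_left less_eq_real_def)
      then show "0 \<le> smat w $ i $ i" by (rule psd_diagonal_nonneg)
    qed
    ultimately have "d * (\<Sum>i\<in>UNIV. smat v $ i $ i) \<le> 2 * (v \<bullet> w)"
      by (simp only: inner_svec)
    moreover have "d * norm v \<le> d * (N * (\<Sum>i\<in>UNIV. smat v $ i $ i))"
      using Gamma_plus_norm_le_trace [OF v] d by (simp add: N_def)
    ultimately have "d * norm v \<le> N * (2 * (v \<bullet> w))"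
      using N by (smt (verit) mult.left_commute mult_left_mono)
    then show "d / (2 * N) * norm v \<le> v \<bullet> w"
      using N by (simp add: field_simps)
  qed
qed

section \<open>Projected block coordinate descent for a composite quadratic\<close>

text \<open>The minimisation of \<open>quad (c - x0 + (\<Sum>i. A i (x i))) - (\<Sum>i. x i \<bullet> b)\<close> over \<open>x0 \<in> S0\<close> and
  \<open>x i \<in> S\<close>, \<open>1 \<le> i \<le> M\<close>, where \<open>quad\<close> is a convex quadratic with Hessian \<open>P\<close>; \<open>A' i\<close> is the
  adjoint of \<open>A i\<close>.  The step parameters \<open>\<rho>0\<close> and \<open>\<rho> i\<close> bound the blocks of the Hessian on the
  diagonal.  Block 0 has a type of its own, and values of \<open>x\<close> outside \<open>{1..M}\<close> play no role.\<close>

locale quadratic_blocks =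
  fixes P :: "'l::euclidean_space \<Rightarrow> 'l" and a c :: 'l
    and A :: "nat \<Rightarrow> 'x::euclidean_space \<Rightarrow> 'l" and A' :: "nat \<Rightarrow> 'l \<Rightarrow> 'x" and b :: 'x
    and M :: nat and S0 :: "'l set" and S :: "'x set" and \<rho>0 :: real and \<rho> :: "nat \<Rightarrow> real"
  assumes linear_P: "linear P"
    and P_sym: "\<And>x y. x \<bullet> P y = P x \<bullet> y"
    and P_nonneg: "\<And>x. 0 \<le> x \<bullet> P x"
    and linear_A: "\<And>i. i \<in> {1..M} \<Longrightarrow> linear (A i)"
    and adjoint_A: "\<And>i x y. i \<in> {1..M} \<Longrightarrow> A i x \<bullet> y = x \<bullet> A' i y"
    and linear_A': "\<And>i. i \<in> {1..M} \<Longrightarrow> linear (A' i)"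
    and S0: "closed S0" "convex S0" "S0 \<noteq> {}"
    and S: "closed S" "convex S" "S \<noteq> {}"
    and \<rho>0: "\<rho>0 > 0" "\<And>h. h \<bullet> P h \<le> \<rho>0 * (h \<bullet> h)"
    and \<rho>: "\<And>i. i \<in> {1..M} \<Longrightarrow> \<rho> i > 0"
      "\<And>i h. i \<in> {1..M} \<Longrightarrow> A i h \<bullet> P (A i h) \<le> \<rho> i * (h \<bullet> h)"
begin

text \<open>The affine map inside the quadratic.\<close>

definition residual :: "'l \<Rightarrow> (nat \<Rightarrow> 'x) \<Rightarrow> 'l" where
  "residual x0 x = c - x0 + (\<Sum>i=1..M. A i (x i))"

text \<open>The quadratic part, with gradient \<open>P l - a\<close>.\<close>

definition quad :: "'l \<Rightarrow> real" where
  "quad l = l \<bullet> P l / 2 - l \<bullet> a"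

text \<open>The smooth part of the problem; the constraints are kept apart in \<open>feasible\<close>.\<close>

definition objective :: "'l \<Rightarrow> (nat \<Rightarrow> 'x) \<Rightarrow> real" where
  "objective x0 x = quad (residual x0 x) - (\<Sum>i=1..M. x i \<bullet> b)"

text \<open>The constraints, on the blocks that matter.\<close>

definition feasible :: "'l \<Rightarrow> (nat \<Rightarrow> 'x) \<Rightarrow> bool" where
  "feasible x0 x \<longleftrightarrow> x0 \<in> S0 \<and> (\<forall>i\<in>{1..M}. x i \<in> S)"

text \<open>One sweep of projected gradient steps on the blocks \<open>M, \<dots>, 1, 0\<close>, from \<open>(x0, x)\<close> to
  \<open>(y0, y)\<close>.  The partial gradient of block \<open>i\<close> is taken at \<open>mixed i x y\<close>, where the blocks above
  \<open>i\<close> are new; that of block 0 is taken with all the other blocks new.\<close>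

definition sweep :: "'l \<Rightarrow> (nat \<Rightarrow> 'x) \<Rightarrow> 'l \<Rightarrow> (nat \<Rightarrow> 'x) \<Rightarrow> bool" where
  "sweep x0 x y0 y \<longleftrightarrow>
    (\<forall>i\<in>{1..M}. y i = closest_point S
        (x i - (1 / \<rho> i) *\<^sub>R (A' i (P (residual x0 (mixed i x y)) - a) - b))) \<and>
    y0 = closest_point S0 (x0 - (1 / \<rho>0) *\<^sub>R (a - P (residual x0 y)))"

lemma quad_expand: "quad (l + h) = quad l + h \<bullet> (P l - a) + h \<bullet> P h / 2"
  using P_sym [of l h]
  by (simp add: quad_def linear_add [OF linear_P] inner_add_left inner_add_right inner_diff_right
      inner_commute [of "P l" h] field_simps)

lemma quad_above_tangent: "quad l + (m - l) \<bullet> (P l - a) \<le> quad m"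
  using quad_expand [of l "m - l"] P_nonneg [of "m - l"] by simp

lemma projected_step_decrease:
  fixes T :: "'y::euclidean_space set"
  assumes T: "closed T" "convex T" "x \<in> T" and r: "r > 0"
    and y: "y = closest_point T (x - (1 / r) *\<^sub>R g)"
  shows "g \<bullet> (y - x) \<le> - r * ((y - x) \<bullet> (y - x))"
proof -
  have "(x - (1 / r) *\<^sub>R g - y) \<bullet> (x - y) \<le> 0"
    unfolding y using T by (intro closest_point_dot)
  then have "(y - x) \<bullet> (y - x) + (g \<bullet> (y - x)) / r \<le> 0"
    by (simp add: inner_diff_left inner_diff_right inner_commute diff_divide_distrib)
  then show ?thesis using r by (simp add: field_simps)
qed

lemma projected_step_optimality:
  fixes T :: "'y::euclidean_space set"
  assumes T: "closed T" "convex T" "z \<in> T" and r: "r > 0"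
    and y: "y = closest_point T (x - (1 / r) *\<^sub>R g)"
  shows "g \<bullet> (y - z) \<le> r * norm (y - x) * norm (y - z)"
proof -
  have "(x - (1 / r) *\<^sub>R g - y) \<bullet> (z - y) \<le> 0"
    unfolding y using T by (intro closest_point_dot)
  then have "(g \<bullet> (y - z)) / r \<le> (y - x) \<bullet> (z - y)"
    by (simp add: inner_diff_left inner_diff_right inner_commute diff_divide_distrib)
  also have "\<dots> \<le> norm (y - x) * norm (z - y)" by (rule norm_cauchy_schwarz)
  finally show ?thesis using r by (simp add: field_simps norm_minus_commute)
qed

lemma residual_cong:
  "(\<And>i. i \<in> {1..M} \<Longrightarrow> x i = y i) \<Longrightarrow> residual x0 x = residual x0 y"
  by (auto simp: residual_def intro: sum.cong)

lemma residual_mixed_0: "residual x0 (mixed 0 x y) = residual x0 y"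
  by (rule residual_cong) (simp add: mixed_def)

lemma residual_mixed_M: "residual x0 (mixed M x y) = residual x0 x"
  by (rule residual_cong) (simp add: mixed_def)

lemma sum_mixed_step:
  fixes f :: "nat \<Rightarrow> 'x \<Rightarrow> 'v::real_vector"
  assumes "i \<in> {1..M}"
  shows "(\<Sum>j=1..M. f j (mixed (i - 1) x y j)) = (\<Sum>j=1..M. f j (mixed i x y j)) + (f i (y i) - f i (x i))"
proof -
  have "(\<Sum>j=1..M. f j (mixed (i - 1) x y j)) - (\<Sum>j=1..M. f j (mixed i x y j))
      = (\<Sum>j=1..M. if j = i then f i (y i) - f i (x i) else 0)"
    using assms by (subst sum_subtractf [symmetric], intro sum.cong) (auto simp: mixed_def)
  also have "\<dots> = f i (y i) - f i (x i)" using assms by simp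
  finally show ?thesis by (simp add: algebra_simps)
qed

lemma residual_mixed_step:
  assumes "i \<in> {1..M}"
  shows "residual x0 (mixed (i - 1) x y) = residual x0 (mixed i x y) + A i (y i - x i)"
  using sum_mixed_step [OF assms, of A x y]
  by (simp add: residual_def linear_diff [OF linear_A [OF assms]])

lemma residual_diff_0: "residual y0 y = residual x0 y + (x0 - y0)"
  by (simp add: residual_def)

text \<open>The descent lemma for one block: the projection yields the decrease \<open>\<rho> \<parallel>d\<parallel>\<^sup>2\<close> to first order,
  and the quadratic term takes back at most half of it.\<close>

lemma objective_mixed_step:
  assumes i: "i \<in> {1..M}" and xi: "x i \<in> S"
    and y: "y i = closest_point S
        (x i - (1 / \<rho> i) *\<^sub>R (A' i (P (residual x0 (mixed i x y)) - a) - b))"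
  shows "objective x0 (mixed (i - 1) x y) + \<rho> i / 2 * (norm (y i - x i))\<^sup>2
    \<le> objective x0 (mixed i x y)"
proof -
  let ?d = "y i - x i" and ?l = "residual x0 (mixed i x y)"
  have "objective x0 (mixed (i - 1) x y) =
      objective x0 (mixed i x y) + (A' i (P ?l - a) - b) \<bullet> ?d + A i ?d \<bullet> P (A i ?d) / 2"
  proof -
    have "quad (residual x0 (mixed (i - 1) x y)) = quad ?l + ?d \<bullet> A' i (P ?l - a) + A i ?d \<bullet> P (A i ?d) / 2"
      unfolding residual_mixed_step [OF i] quad_expand adjoint_A [OF i] ..
    moreover have "(\<Sum>j=1..M. mixed (i - 1) x y j \<bullet> b) = (\<Sum>j=1..M. mixed i x y j \<bullet> b) + ?d \<bullet> b"
      using sum_mixed_step [OF i, of "\<lambda>_ v. v \<bullet> b" x y] by (simp add: inner_diff_left)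
    moreover have "(A' i (P ?l - a) - b) \<bullet> ?d = ?d \<bullet> A' i (P ?l - a) - ?d \<bullet> b"
      by (metis inner_commute inner_diff_right)
    ultimately show ?thesis by (simp add: objective_def)
  qed
  moreover have "(A' i (P ?l - a) - b) \<bullet> ?d \<le> - \<rho> i * (?d \<bullet> ?d)"
    using S(1,2) xi \<rho>(1) [OF i] y by (rule projected_step_decrease)
  moreover have "A i ?d \<bullet> P (A i ?d) \<le> \<rho> i * (?d \<bullet> ?d)" by (rule \<rho>(2) [OF i])
  ultimately show ?thesis by (simp add: power2_norm_eq_inner)
qed

lemma objective_step_0:
  assumes x0: "x0 \<in> S0" and y0: "y0 = closest_point S0 (x0 - (1 / \<rho>0) *\<^sub>R (a - P (residual x0 y)))"
  shows "objective y0 y + \<rho>0 / 2 * (norm (y0 - x0))\<^sup>2 \<le> objective x0 y"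
proof -
  let ?d = "y0 - x0" and ?l = "residual x0 y"
  have "quad (residual y0 y) = quad ?l + (x0 - y0) \<bullet> (P ?l - a) + (x0 - y0) \<bullet> P (x0 - y0) / 2"
    by (simp only: residual_diff_0 [of y0 y x0] quad_expand)
  moreover have "(x0 - y0) \<bullet> (P ?l - a) = (a - P ?l) \<bullet> ?d"
    by (simp add: inner_diff_left inner_diff_right inner_commute)
  moreover have "(a - P ?l) \<bullet> ?d \<le> - \<rho>0 * (?d \<bullet> ?d)"
    using S0(1,2) x0 \<rho>0(1) y0 by (rule projected_step_decrease)
  moreover have "(x0 - y0) \<bullet> P (x0 - y0) \<le> \<rho>0 * (?d \<bullet> ?d)"
    using \<rho>0(2) [of "x0 - y0"] by (simp add: dot_square_norm norm_minus_commute)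
  ultimately show ?thesis by (simp add: objective_def power2_norm_eq_inner)
qed

lemma sweep_feasible:
  assumes "sweep x0 x y0 y"
  shows "feasible y0 y"
  using assms S0 S by (auto simp: sweep_def feasible_def closest_point_in_set)

lemma objective_mixed_decrease:
  assumes sw: "sweep x0 x y0 y" and f: "feasible x0 x" and ij: "i \<le> j" "j \<le> M"
  shows "objective x0 (mixed i x y) + (\<Sum>m\<in>{i<..j}. \<rho> m / 2 * (norm (y m - x m))\<^sup>2)
    \<le> objective x0 (mixed j x y)"
  using ij
proof (induction j rule: dec_induct)
  case base
  then show ?case by simp
next
  case (step j)
  have j: "Suc j \<in> {1..M}" using step by simp
  have "objective x0 (mixed (Suc j - 1) x y) + \<rho> (Suc j) / 2 * (norm (y (Suc j) - x (Suc j)))\<^sup>2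
    \<le> objective x0 (mixed (Suc j) x y)"
    using sw f j by (intro objective_mixed_step) (auto simp: sweep_def feasible_def)
  moreover have "{i<..Suc j} = insert (Suc j) {i<..j}" using step by auto
  ultimately show ?case using step by simp
qed

lemma sweep_decrease:
  assumes sw: "sweep x0 x y0 y" and f: "feasible x0 x"
  shows "objective y0 y + \<rho>0 / 2 * (norm (y0 - x0))\<^sup>2
      + (\<Sum>m=1..M. \<rho> m / 2 * (norm (y m - x m))\<^sup>2) \<le> objective x0 x"
proof -
  have "objective y0 y + \<rho>0 / 2 * (norm (y0 - x0))\<^sup>2 \<le> objective x0 y"
    using sw f by (intro objective_step_0) (auto simp: sweep_def feasible_def)
  moreover have "objective x0 (mixed 0 x y) = objective x0 y"
    by (simp add: objective_def residual_mixed_0) (simp add: mixed_def)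
  moreover have "objective x0 (mixed M x y) = objective x0 x"
    by (simp add: objective_def residual_mixed_M) (simp add: mixed_def)
  moreover have "{0<..M} = {1..M}" by auto
  ultimately show ?thesis
    using objective_mixed_decrease [OF sw f, of 0 M] by simp
qed

lemma sweep_step_norms:
  assumes sw: "sweep x0 x y0 y" and f: "feasible x0 x"
  defines "\<delta> \<equiv> objective x0 x - objective y0 y"
  shows "0 \<le> \<delta>" "norm (y0 - x0) \<le> sqrt (2 / \<rho>0) * sqrt \<delta>"
    "\<And>i. i \<in> {1..M} \<Longrightarrow> norm (y i - x i) \<le> sqrt (2 / \<rho> i) * sqrt \<delta>"
proof -
  let ?t = "\<lambda>m. \<rho> m / 2 * (norm (y m - x m))\<^sup>2"
  have t: "?t m \<ge> 0" if "m \<in> {1..M}" for m using \<rho>(1) [OF that] by simp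
  have t0: "\<rho>0 / 2 * (norm (y0 - x0))\<^sup>2 \<ge> 0" using \<rho>0 by simp
  have dec: "\<rho>0 / 2 * (norm (y0 - x0))\<^sup>2 + sum ?t {1..M} \<le> \<delta>"
    using sweep_decrease [OF sw f] by (simp add: \<delta>_def)
  have s: "sum ?t {1..M} \<ge> 0" using t by (rule sum_nonneg)
  show "0 \<le> \<delta>" using dec s t0 by linarith
  have root: "norm v \<le> sqrt (2 / r) * sqrt \<delta>" if "r > 0" "r / 2 * (norm v)\<^sup>2 \<le> \<delta>" for v :: "'y::real_normed_vector" and r
  proof -
    have "(norm v)\<^sup>2 \<le> 2 / r * \<delta>" using that by (simp add: field_simps)
    then have "norm v \<le> sqrt (2 / r * \<delta>)" by (rule real_le_rsqrt)
    then show ?thesis by (simp only: real_sqrt_mult)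
  qed
  show "norm (y0 - x0) \<le> sqrt (2 / \<rho>0) * sqrt \<delta>"
    using \<rho>0 dec s by (intro root) auto
  fix i assume i: "i \<in> {1..M}"
  have "?t i \<le> sum ?t {1..M}" using t i by (intro member_le_sum) auto
  then have "?t i \<le> \<delta>" using dec t0 by linarith
  then show "norm (y i - x i) \<le> sqrt (2 / \<rho> i) * sqrt \<delta>"
    using \<rho>(1) [OF i] by (intro root) auto
qed

lemma residual_mixed_diff:
  assumes "i \<le> M"
  shows "residual y0 y - residual x0 (mixed i x y) = (x0 - y0) + (\<Sum>j=1..i. A j (y j - x j))"
  using assms
proof (induction i)
  case 0
  then show ?case by (simp add: residual_mixed_0 residual_diff_0 [of y0 y x0])
next
  case (Suc i)
  then show ?case using residual_mixed_step [of "Suc i" x0 x y] by (simp add: algebra_simps)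
qed

lemma sweep_residual_change:
  obtains B where "B \<ge> 0"
    "\<And>x0 x y0 y i. sweep x0 x y0 y \<Longrightarrow> feasible x0 x \<Longrightarrow> i \<le> M \<Longrightarrow>
      norm (residual y0 y - residual x0 (mixed i x y))
      \<le> B * sqrt (objective x0 x - objective y0 y)"
proof -
  have "\<exists>K. \<forall>v. norm (A j v) \<le> norm v * K" if "j \<in> {1..M}" for j
    using linear_A [OF that] bounded_linear.bounded linear_conv_bounded_linear by blast
  then obtain K where K: "\<And>j v. j \<in> {1..M} \<Longrightarrow> norm (A j v) \<le> norm v * K j" by metis
  define B where "B = sqrt (2 / \<rho>0) + (\<Sum>j=1..M. sqrt (2 / \<rho> j) * \<bar>K j\<bar>)"
  have nn: "sqrt (2 / \<rho> j) * \<bar>K j\<bar> \<ge> 0" if "j \<in> {1..M}" for j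
    using \<rho>(1) [OF that] by simp
  show ?thesis
  proof
    show "B \<ge> 0" unfolding B_def using \<rho>0 nn by (intro add_nonneg_nonneg sum_nonneg) auto
    fix x0 x y0 y i assume sw: "sweep x0 x y0 y" and f: "feasible x0 x" and i: "i \<le> M"
    let ?s = "sqrt (objective x0 x - objective y0 y)"
    note st = sweep_step_norms [OF sw f]
    have s: "?s \<ge> 0" using st(1) by simp
    have A: "norm (A j (y j - x j)) \<le> sqrt (2 / \<rho> j) * \<bar>K j\<bar> * ?s" if "j \<in> {1..M}" for j
    proof -
      have "norm (A j (y j - x j)) \<le> norm (y j - x j) * \<bar>K j\<bar>"
        using K [OF that, of "y j - x j"] by (meson abs_ge_self mult_left_mono norm_ge_zero order_trans)
      also have "\<dots> \<le> sqrt (2 / \<rho> j) * ?s * \<bar>K j\<bar>"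
        using st(3) [OF that] by (rule mult_right_mono) simp
      finally show ?thesis by (simp add: mult_ac)
    qed
    have "norm (residual y0 y - residual x0 (mixed i x y))
        \<le> norm (x0 - y0) + norm (\<Sum>j=1..i. A j (y j - x j))"
      unfolding residual_mixed_diff [OF i] by (rule norm_triangle_ineq)
    also have "\<dots> \<le> sqrt (2 / \<rho>0) * ?s + (\<Sum>j=1..i. sqrt (2 / \<rho> j) * \<bar>K j\<bar> * ?s)"
      using st(2) A i by (intro add_mono sum_norm_le) (auto simp: norm_minus_commute)
    also have "\<dots> \<le> sqrt (2 / \<rho>0) * ?s + (\<Sum>j=1..M. sqrt (2 / \<rho> j) * \<bar>K j\<bar> * ?s)"
      using i nn s by (intro add_left_mono sum_mono2) auto
    finally show "norm (residual y0 y - residual x0 (mixed i x y)) \<le> B * ?s"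
      by (simp add: B_def distrib_right sum_distrib_right)
  qed
qed

lemma objective_gap_le_gradient:
  "objective y0 y - objective z0 z \<le> (a - P (residual y0 y)) \<bullet> (y0 - z0)
    + (\<Sum>i=1..M. (A' i (P (residual y0 y) - a) - b) \<bullet> (y i - z i))"
proof -
  let ?g = "P (residual y0 y) - a"
  have "residual z0 z - residual y0 y = (y0 - z0) - (\<Sum>i=1..M. A i (y i - z i))"
    by (simp add: residual_def linear_diff linear_A sum_subtractf)
  then have "(residual z0 z - residual y0 y) \<bullet> ?g = (y0 - z0) \<bullet> ?g - (\<Sum>i=1..M. A' i ?g \<bullet> (y i - z i))"
    by (simp only: inner_diff_left [of "y0 - z0"] inner_sum_left)
      (simp add: adjoint_A inner_commute [of "y _ - z _"])
  moreover have "quad (residual y0 y) + (residual z0 z - residual y0 y) \<bullet> ?g \<le> quad (residual z0 z)"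
    by (rule quad_above_tangent)
  moreover have "(\<Sum>i=1..M. (A' i ?g - b) \<bullet> (y i - z i)) =
      (\<Sum>i=1..M. A' i ?g \<bullet> (y i - z i)) - ((\<Sum>i=1..M. y i \<bullet> b) - (\<Sum>i=1..M. z i \<bullet> b))"
    by (simp add: inner_diff_left inner_diff_right sum_subtractf inner_commute)
  moreover have "(y0 - z0) \<bullet> ?g = - ((a - P (residual y0 y)) \<bullet> (y0 - z0))"
    by (simp add: inner_diff_left inner_diff_right inner_commute)
  ultimately show ?thesis by (simp add: objective_def)
qed

text \<open>The gradient \<open>g\<close> at the end of a sweep differs from the gradient \<open>h\<close> used in the update of a
  block from \<open>u\<close> to \<open>v\<close> by an amount of the size \<open>s\<close> of the sweep, so \<open>g\<close> almost satisfies the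
  optimality condition of the projection.\<close>

lemma perturbed_block_gap:
  fixes g h u v w :: "'y::euclidean_space"
  assumes gh: "norm (g - h) \<le> k * (B * s)" and opt: "h \<bullet> (v - w) \<le> r * norm (v - u) * norm (v - w)"
    and vu: "norm (v - u) \<le> t * s" and vw: "norm (v - w) \<le> D"
    and r: "r \<ge> 0"
  shows "g \<bullet> (v - w) \<le> (k * B + r * t) * D * s"
proof -
  have "g \<bullet> (v - w) = (g - h) \<bullet> (v - w) + h \<bullet> (v - w)" by (simp add: inner_diff_left)
  also have "\<dots> \<le> norm (g - h) * norm (v - w) + r * norm (v - u) * norm (v - w)"
    using norm_cauchy_schwarz [of "g - h" "v - w"] opt by linarith
  also have "\<dots> \<le> k * (B * s) * D + r * (t * s) * D"
  proof (rule add_mono)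
    show "norm (g - h) * norm (v - w) \<le> k * (B * s) * D"
      using gh vw order_trans [OF norm_ge_zero gh] by (rule mult_mono) simp
    have "r * norm (v - u) \<le> r * (t * s)" using vu r by (rule mult_left_mono)
    then show "r * norm (v - u) * norm (v - w) \<le> r * (t * s) * D"
      using vw r order_trans [OF norm_ge_zero vu] by (intro mult_mono [OF _ vw]) auto
  qed
  also have "\<dots> = (k * B + r * t) * D * s" by (simp add: algebra_simps)
  finally show ?thesis .
qed

text \<open>The gap to a feasible point is bounded by the distance to it, times the square root of the
  decrease in the last sweep.\<close>

lemma sweep_gap:
  obtains C where "C \<ge> 0"
    "\<And>x0 x y0 y z0 z D. sweep x0 x y0 y \<Longrightarrow> feasible x0 x \<Longrightarrow> feasible z0 z \<Longrightarrow>
      norm (y0 - z0) \<le> D \<Longrightarrow> (\<And>i. i \<in> {1..M} \<Longrightarrow> norm (y i - z i) \<le> D) \<Longrightarrow>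
      objective y0 y - objective z0 z \<le> C * D * sqrt (objective x0 x - objective y0 y)"
proof -
  obtain B where B: "B \<ge> 0" "\<And>x0 x y0 y i. sweep x0 x y0 y \<Longrightarrow> feasible x0 x \<Longrightarrow> i \<le> M \<Longrightarrow>
      norm (residual y0 y - residual x0 (mixed i x y)) \<le> B * sqrt (objective x0 x - objective y0 y)"
    using sweep_residual_change by blast
  have "\<exists>K. \<forall>v. norm (A' j (P v)) \<le> norm v * K" if "j \<in> {1..M}" for j
    using bounded_linear.bounded linear_conv_bounded_linear
      linear_compose [OF linear_P linear_A' [OF that]] by (fastforce simp: o_def)
  then obtain K where K: "\<And>j v. j \<in> {1..M} \<Longrightarrow> norm (A' j (P v)) \<le> norm v * K j" by metis
  obtain K0 where K0: "\<And>v. norm (P v) \<le> norm v * K0"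
    using linear_P bounded_linear.bounded linear_conv_bounded_linear by blast
  have K0nn: "norm (P v) \<le> \<bar>K0\<bar> * norm v" for v
    using K0 [of v] by (metis abs_ge_self mult.commute mult_left_mono norm_ge_zero order_trans)
  have Knn: "norm (A' j (P v)) \<le> \<bar>K j\<bar> * norm v" if "j \<in> {1..M}" for j v
    using K [OF that, of v] by (metis abs_ge_self mult.commute mult_left_mono norm_ge_zero order_trans)
  define C0 where "C0 = \<bar>K0\<bar> * B + \<rho>0 * sqrt (2 / \<rho>0)"
  define C where "C i = \<bar>K i\<bar> * B + \<rho> i * sqrt (2 / \<rho> i)" for i
  show ?thesis
  proof
    have "C0 \<ge> 0" using B(1) \<rho>0 by (simp add: C0_def)
    moreover have "C i \<ge> 0" if "i \<in> {1..M}" for i using B(1) \<rho>(1) [OF that] by (simp add: C_def)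
    ultimately show "C0 + (\<Sum>i=1..M. C i) \<ge> 0" by (intro add_nonneg_nonneg sum_nonneg) auto
    fix x0 x y0 y z0 z D
    assume sw: "sweep x0 x y0 y" and f: "feasible x0 x" and fz: "feasible z0 z"
      and D0: "norm (y0 - z0) \<le> D" and D: "\<And>i. i \<in> {1..M} \<Longrightarrow> norm (y i - z i) \<le> D"
    let ?s = "sqrt (objective x0 x - objective y0 y)" and ?l = "residual y0 y"
    note st = sweep_step_norms [OF sw f]
    have s: "?s \<ge> 0" using st(1) by simp
    have Dnn: "D \<ge> 0" using D0 norm_ge_zero order_trans by blast
    have b0: "(a - P ?l) \<bullet> (y0 - z0) \<le> C0 * D * ?s"
      unfolding C0_def
    proof (rule perturbed_block_gap [where h = "a - P (residual x0 y)" and u = x0])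
      have "norm (a - P ?l - (a - P (residual x0 y))) = norm (P (residual x0 y - ?l))"
        by (simp add: linear_diff [OF linear_P])
      also have "\<dots> \<le> \<bar>K0\<bar> * norm (?l - residual x0 y)"
        using K0nn by (metis norm_minus_commute)
      also have "\<dots> \<le> \<bar>K0\<bar> * (B * ?s)"
        using B(2) [OF sw f, of 0] by (intro mult_left_mono) (auto simp: residual_mixed_0)
      finally show "norm (a - P ?l - (a - P (residual x0 y))) \<le> \<bar>K0\<bar> * (B * ?s)" .
      show "(a - P (residual x0 y)) \<bullet> (y0 - z0) \<le> \<rho>0 * norm (y0 - x0) * norm (y0 - z0)"
        using sw fz by (intro projected_step_optimality [OF S0(1,2) _ \<rho>0(1)])
          (auto simp: feasible_def sweep_def)
    qed (use st \<rho>0 D0 in auto)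
    have bi: "(A' i (P ?l - a) - b) \<bullet> (y i - z i) \<le> C i * D * ?s" if i: "i \<in> {1..M}" for i
      unfolding C_def
    proof (rule perturbed_block_gap [where h = "A' i (P (residual x0 (mixed i x y)) - a) - b" and u = "x i"])
      let ?m = "residual x0 (mixed i x y)"
      have "norm (A' i (P ?l - a) - b - (A' i (P ?m - a) - b)) = norm (A' i (P (?l - ?m)))"
        by (simp add: linear_diff [OF linear_P] linear_diff [OF linear_A' [OF i]])
      also have "\<dots> \<le> \<bar>K i\<bar> * norm (?l - ?m)" by (rule Knn [OF i])
      also have "\<dots> \<le> \<bar>K i\<bar> * (B * ?s)"
        using B(2) [OF sw f, of i] i by (intro mult_left_mono) auto
      finally show "norm (A' i (P ?l - a) - b - (A' i (P ?m - a) - b)) \<le> \<bar>K i\<bar> * (B * ?s)" .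
      show "(A' i (P ?m - a) - b) \<bullet> (y i - z i) \<le> \<rho> i * norm (y i - x i) * norm (y i - z i)"
        using sw fz i by (intro projected_step_optimality [OF S(1,2) _ \<rho>(1) [OF i]])
          (auto simp: feasible_def sweep_def)
    qed (use st(3) [OF i] \<rho>(1) [OF i] D [OF i] in auto)
    have "objective y0 y - objective z0 z \<le> C0 * D * ?s + (\<Sum>i=1..M. C i * D * ?s)"
      by (rule order_trans [OF objective_gap_le_gradient]) (intro add_mono b0 sum_mono bi)
    then show "objective y0 y - objective z0 z \<le> (C0 + (\<Sum>i=1..M. C i)) * D * ?s"
      by (simp add: distrib_right sum_distrib_right)
  qed
qed

text \<open>A point \<open>w\<close> in the interior of the dual cone of \<open>S0\<close>, whose images \<open>- b - A' i w\<close> lie in the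
  interior of the dual cone of \<open>S\<close>, makes the objective grow linearly: the tangent of \<^const>\<open>quad\<close>
  with gradient \<open>- w\<close> is a lower bound with this property.\<close>

lemma objective_coercive:
  assumes u: "P u = a - w"
    and x0: "\<And>v. v \<in> S0 \<Longrightarrow> \<kappa> * norm v \<le> v \<bullet> w"
    and x: "\<And>i v. i \<in> {1..M} \<Longrightarrow> v \<in> S \<Longrightarrow> \<kappa> * norm v \<le> v \<bullet> (- b - A' i w)"
    and f: "feasible z0 z"
  shows "\<kappa> * (norm z0 + (\<Sum>i=1..M. norm (z i))) - (c \<bullet> w - u \<bullet> w - quad u) \<le> objective z0 z"
proof -
  have "residual z0 z \<bullet> w = c \<bullet> w - z0 \<bullet> w + (\<Sum>i=1..M. z i \<bullet> A' i w)"
    by (simp add: residual_def inner_add_left inner_diff_left inner_sum_left adjoint_A)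
  moreover have "quad u + (residual z0 z - u) \<bullet> (- w) \<le> quad (residual z0 z)"
    using quad_above_tangent [of u "residual z0 z"] by (simp add: u)
  moreover have "\<kappa> * norm z0 \<le> z0 \<bullet> w" using f x0 by (simp add: feasible_def)
  moreover have "(\<Sum>i=1..M. \<kappa> * norm (z i)) \<le> (\<Sum>i=1..M. z i \<bullet> (- b - A' i w))"
    using f x by (intro sum_mono) (auto simp: feasible_def)
  moreover have "(\<Sum>i=1..M. z i \<bullet> (- b - A' i w)) = - (\<Sum>i=1..M. z i \<bullet> b) - (\<Sum>i=1..M. z i \<bullet> A' i w)"
    by (simp add: inner_diff_right sum_subtractf sum_negf)
  ultimately show ?thesis
    by (simp add: objective_def inner_diff_left distrib_left sum_distrib_left)
qed

text \<open>By coercivity the sublevel set of the first iterate is bounded, so the distance in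
  \<open>sweep_gap\<close> is bounded uniformly in \<open>k\<close> and over the comparison points that matter.  Passing to
  the infimum bounds the square of the optimality gap after a sweep by a multiple of the decrease
  in that sweep.  The initial point need not be feasible; every later one is.\<close>

theorem sweep_rate:
  assumes coercive: "\<kappa> > 0"
      "\<And>z0 z. feasible z0 z \<Longrightarrow> \<kappa> * (norm z0 + (\<Sum>i=1..M. norm (z i))) - B \<le> objective z0 z"
    and iter: "\<And>k. sweep (x0 k) (x k) (x0 (Suc k)) (x (Suc k))"
  shows "\<exists>r. \<forall>k\<ge>1. \<forall>z0 z. feasible z0 z \<longrightarrow> objective (x0 k) (x k) - objective z0 z \<le> r / real k"
proof -
  have feas: "feasible (x0 k) (x k)" if "k \<ge> 1" for k
    using sweep_feasible [OF iter, of "k - 1"] that by simp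
  define V where "V = {objective z0 z |z0 z. feasible z0 z}"
  define vmin where "vmin = Inf V"
  have bdd: "bdd_below V"
  proof (rule bdd_belowI)
    fix v assume "v \<in> V"
    then obtain z0 z where "feasible z0 z" and v: "v = objective z0 z" by (auto simp: V_def)
    moreover have "\<kappa> * (norm z0 + (\<Sum>i=1..M. norm (z i))) \<ge> 0"
      using coercive(1) by (intro mult_nonneg_nonneg add_nonneg_nonneg sum_nonneg) auto
    ultimately show "- B \<le> v" using coercive(2) [of z0 z] by simp
  qed
  have vmin_le: "vmin \<le> objective z0 z" if "feasible z0 z" for z0 z
    unfolding vmin_def using bdd that by (intro cInf_lower) (auto simp: V_def)
  have V_ne: "V \<noteq> {}" using feas [of 1] by (auto simp: V_def)
  define e where "e k = objective (x0 k) (x k) - vmin" for k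
  have decr: "e (Suc k) \<le> e k" if "k \<ge> 1" for k
    using sweep_step_norms(1) [OF iter feas [OF that]] by (simp add: e_def)
  have e1: "e k \<le> e 1" if "k \<ge> 1" for k
    using that by (induction k rule: dec_induct) (use decr in force)+
  define v1 where "v1 = objective (x0 1) (x 1)"
  define N where "N = (v1 + B) / \<kappa>"
  have bounded: "norm z0 \<le> N \<and> (\<forall>i\<in>{1..M}. norm (z i) \<le> N)"
    if f: "feasible z0 z" and le: "objective z0 z \<le> v1" for z0 z
  proof -
    have "\<kappa> * (norm z0 + (\<Sum>i=1..M. norm (z i))) \<le> v1 + B" using coercive(2) [OF f] le by linarith
    then have *: "norm z0 + (\<Sum>i=1..M. norm (z i)) \<le> N"
      using coercive(1) by (simp add: N_def field_simps)
    have "norm (z i) \<le> N" if "i \<in> {1..M}" for i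
    proof -
      have "norm (z i) \<le> (\<Sum>i=1..M. norm (z i))" using that by (intro member_le_sum) auto
      then show ?thesis using * norm_ge_zero [of z0] by linarith
    qed
    moreover have "(\<Sum>i=1..M. norm (z i)) \<ge> 0" by (simp add: sum_nonneg)
    ultimately show ?thesis using * by auto
  qed
  obtain C where C: "C \<ge> 0"
    "\<And>x0 x y0 y z0 z D. sweep x0 x y0 y \<Longrightarrow> feasible x0 x \<Longrightarrow> feasible z0 z \<Longrightarrow>
      norm (y0 - z0) \<le> D \<Longrightarrow> (\<And>i. i \<in> {1..M} \<Longrightarrow> norm (y i - z i) \<le> D) \<Longrightarrow>
      objective y0 y - objective z0 z \<le> C * D * sqrt (objective x0 x - objective y0 y)"
    using sweep_gap by blast
  have "norm (x0 1) \<le> N" using bounded [OF feas [of 1]] by (simp add: v1_def)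
  then have N: "N \<ge> 0" using norm_ge_zero order_trans by blast
  define G where "G = C * (2 * N) + 1"
  have G: "G > 0" using C(1) N by (simp add: G_def add_nonneg_pos)
  have gap: "e (Suc k) \<le> G * sqrt (e k - e (Suc k))" if k: "k \<ge> 1" for k
  proof -
    let ?v = "x0 (Suc k)" and ?y = "x (Suc k)"
    let ?s = "sqrt (objective (x0 k) (x k) - objective ?v ?y)"
    have s: "?s \<ge> 0" using decr [OF k] by (simp add: e_def)
    have Gs: "0 \<le> G * ?s" using G s by simp
    have fy: "feasible ?v ?y" by (rule feas) simp
    have yv1: "objective ?v ?y \<le> v1" using e1 [of "Suc k"] by (simp add: e_def v1_def)
    have *: "objective ?v ?y - G * ?s \<le> objective z0 z" if fz: "feasible z0 z" for z0 z
    proof (cases "objective z0 z \<le> v1")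
      case True
      have "objective ?v ?y - objective z0 z \<le> C * (2 * N) * ?s"
      proof (rule C(2) [OF iter feas [OF k] fz])
        show "norm (?v - z0) \<le> 2 * N"
          using bounded [OF fy yv1] bounded [OF fz True] norm_triangle_ineq4 [of ?v z0] by linarith
        show "norm (?y i - z i) \<le> 2 * N" if "i \<in> {1..M}" for i
          using bounded [OF fy yv1] bounded [OF fz True] norm_triangle_ineq4 [of "?y i" "z i"] that
          by fastforce
      qed
      also have "\<dots> \<le> G * ?s" using s by (intro mult_right_mono) (auto simp: G_def)
      finally show ?thesis by simp
    next
      case False
      then show ?thesis using yv1 Gs by linarith
    qed
    then have "objective ?v ?y - G * ?s \<le> vmin"
      unfolding vmin_def using V_ne by (intro cInf_greatest) (auto simp: V_def)
    then show ?thesis by (simp add: e_def)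
  qed
  have rec: "1 / G\<^sup>2 * (e (Suc k))\<^sup>2 \<le> e k - e (Suc k)" if k: "k \<ge> 1" for k
  proof -
    have "0 \<le> e (Suc k)" using vmin_le [OF feas] by (simp add: e_def)
    then have "(e (Suc k))\<^sup>2 \<le> (G * sqrt (e k - e (Suc k)))\<^sup>2"
      using gap [OF k] by (intro power_mono)
    also have "\<dots> = G\<^sup>2 * (e k - e (Suc k))"
      using decr [OF k] by (simp add: power_mult_distrib)
    finally show ?thesis using G by (simp add: field_simps)
  qed
  have "e k \<le> max (e 1) (2 / (1 / G\<^sup>2)) / real k" if "k \<ge> 1" for k
    using quadratic_decrease_rate [of "1 / G\<^sup>2" e k] rec G that by simp
  then show ?thesis
    using vmin_le by (intro exI [of _ "max (e 1) (2 / (1 / G\<^sup>2))"]) (force simp: e_def)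
qed

end

section \<open>The matrices of the dual problem\<close>

text \<open>The diagonal matrix with diagonal \<open>d\<close>.\<close>

definition diag_mat :: "('k \<Rightarrow> real) \<Rightarrow> real^'k^'k" where
  "diag_mat d = (\<chi> i j. if i = j then d i else 0)"

lemma diag_mat_vector: "diag_mat d *v x = (\<chi> i. d i * x $ i)"
  by (simp add: diag_mat_def matrix_vector_mult_def vec_eq_iff if_distribR if_distrib [of "\<lambda>x. x * _"]
      cong: if_cong)

lemma diag_mat_mult: "diag_mat d ** diag_mat e = diag_mat (\<lambda>i. d i * e i)"
  by (simp add: matrix_eq matrix_vector_mul_assoc [symmetric] diag_mat_vector vec_eq_iff mult.assoc)

lemma sym_diag_mat: "sym_mat (diag_mat d)"
  by (auto simp: sym_mat_def diag_mat_def transpose_def vec_eq_iff)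

lemma psd_diag_mat: "(\<And>i. d i \<ge> 0) \<Longrightarrow> psd (diag_mat d)"
  by (auto simp: psd_def sym_diag_mat diag_mat_vector inner_vec_def mult.left_commute intro!: sum_nonneg)

lemma matrix_inv_diag_mat:
  fixes d :: "'k::finite \<Rightarrow> real"
  assumes "\<And>i. d i \<noteq> 0"
  shows "matrix_inv (diag_mat d) = diag_mat (\<lambda>i. 1 / d i)"
proof -
  have "diag_mat d ** diag_mat (\<lambda>i. 1 / d i) = mat 1" "diag_mat (\<lambda>i. 1 / d i) ** diag_mat d = mat 1"
    using assms by (auto simp: diag_mat_mult) (auto simp: diag_mat_def mat_def)
  then have "diag_mat d ** matrix_inv (diag_mat d) = mat 1 \<and> matrix_inv (diag_mat d) ** diag_mat d = mat 1"
    unfolding matrix_inv_def by (intro someI [of "\<lambda>B. diag_mat d ** B = mat 1 \<and> B ** diag_mat d = mat 1"]) simp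
  then show ?thesis
    using \<open>diag_mat d ** diag_mat (\<lambda>i. 1 / d i) = mat 1\<close>
    by (metis matrix_mul_assoc matrix_mul_lid matrix_mul_rid)
qed

text \<open>The number of positions of a full square matrix that \<^const>\<open>svec\<close> represents by one entry:
  1 on the diagonal, 2 off the diagonal.\<close>

definition mult_pos :: "'k uprod \<Rightarrow> real" where
  "mult_pos u = real (card {ij. Upair (fst ij) (snd ij) = u})"

lemma mult_pos_pos: "mult_pos (u :: 'k::finite uprod) > 0"
proof (cases u)
  case (Upair a b)
  then have "(a, b) \<in> {ij. Upair (fst ij) (snd ij) = u}" by simp
  then have "card {ij. Upair (fst ij) (snd ij) = u} > 0" by (subst card_gt_0_iff) auto
  then show ?thesis by (simp add: mult_pos_def)
qed

lemma duplication_matrix_entry: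
  fixes D1 :: "real^('k::finite uprod)^('k \<times> 'k)"
  assumes D1: "\<And>W. sym_mat W \<Longrightarrow> vec_mat W = D1 *v svec W"
  shows "D1 $ ij $ u = (if Upair (fst ij) (snd ij) = u then 1 else 0)"
proof -
  have "D1 *v axis u 1 = vec_mat (smat (axis u 1))"
    using D1 [OF sym_mat_smat [of "axis u 1"]] by (simp add: svec_smat)
  then have "(D1 *v axis u 1) $ ij = (if Upair (snd ij) (fst ij) = u then 1 else 0)"
    by (simp add: vec_mat_def axis_def)
  moreover have "Upair (snd ij) (fst ij) = Upair (fst ij) (snd ij)" by simp
  ultimately show ?thesis by (simp add: matrix_vector_mult_basis column_def)
qed

text \<open>The columns of \<open>D1\<close> belong to different unordered pairs, so they have disjoint supports.
  The Gram matrix is therefore diagonal.\<close>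

lemma duplication_matrix_gram:
  fixes D1 :: "real^('k::finite uprod)^('k \<times> 'k)"
  assumes D1: "\<And>W. sym_mat W \<Longrightarrow> vec_mat W = D1 *v svec W"
  shows "transpose D1 ** D1 = diag_mat mult_pos"
proof -
  have "(transpose D1 ** D1) $ u $ v = diag_mat mult_pos $ u $ v" for u v
  proof -
    have "(transpose D1 ** D1) $ u $ v =
        (\<Sum>ij\<in>UNIV. if Upair (fst ij) (snd ij) = u then (if u = v then 1 else 0) else 0)"
      by (auto simp: matrix_matrix_mult_def transpose_def duplication_matrix_entry [OF D1]
          intro!: sum.cong sum.neutral)
    also have "\<dots> = diag_mat mult_pos $ u $ v"
      by (simp add: sum.If_cases diag_mat_def mult_pos_def)
    finally show ?thesis .
  qed
  then show ?thesis by (simp add: vec_eq_iff)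
qed

lemma kron_vec_mat:
  fixes A :: "real^'b^'a" and B :: "real^'d^'c"
  shows "kron A B *v vec_mat W = vec_mat (B ** W ** transpose A)"
proof -
  have "(kron A B *v vec_mat W) $ ij = vec_mat (B ** W ** transpose A) $ ij" for ij
  proof -
    have "(kron A B *v vec_mat W) $ ij =
        (\<Sum>b\<in>UNIV. \<Sum>d\<in>UNIV. A $ fst ij $ b * B $ snd ij $ d * W $ d $ b)"
      by (simp add: kron_def vec_mat_def matrix_vector_mult_def sum.cartesian_product split_beta)
    also have "\<dots> = vec_mat (B ** W ** transpose A) $ ij"
      by (simp add: vec_mat_def matrix_matrix_mult_def transpose_def sum_distrib_right
          sum_distrib_left mult_ac)
    finally show ?thesis .
  qed
  then show ?thesis by (simp add: vec_eq_iff)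
qed

lemma matrix_add_rdistrib: "(A + B) ** C = A ** C + B ** (C :: real^'k^'j)"
  by (simp add: vec_eq_iff matrix_matrix_mult_def distrib_right sum.distrib)

lemma vec_mat_add: "vec_mat (A + B) = vec_mat A + vec_mat B"
  by (simp add: vec_mat_def vec_eq_iff)

lemma Xi_vec_mat:
  "Xi Fi *v vec_mat W = vec_mat (V2 ** (Fi ** W + W ** transpose Fi) ** transpose V2)"
  by (simp add: Xi_def matrix_vector_mult_add_rdistrib kron_vec_mat vec_mat_add [symmetric]
      matrix_add_ldistrib matrix_add_rdistrib matrix_transpose_mul matrix_mul_assoc add.commute)

lemma sym_mat_congruence:
  fixes V :: "real^'j^'i"
  assumes "sym_mat S"
  shows "sym_mat (V ** S ** transpose V)"
  using assms by (simp add: sym_mat_def matrix_transpose_mul matrix_mul_assoc)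

lemma V2_congruence: "V2 ** S ** transpose V2 = upper_left S"
proof -
  have V2: "V2 $ i $ j = (if j = Inl i then 1 else 0)" for i j
    by (cases j) (auto simp: V2_def mat_def)
  have "(V2 ** S) $ i $ j = S $ Inl i $ j" for i j
    by (simp add: matrix_matrix_mult_def V2 if_distrib [of "\<lambda>x. x * _"] cong: if_cong)
  then show ?thesis
    by (simp add: vec_eq_iff matrix_matrix_mult_def [of "V2 ** S"] transpose_def V2 upper_left_def
        if_distrib [of "\<lambda>x. _ * x"] cong: if_cong)
qed

text \<open>In the coordinates of \<^const>\<open>svec\<close>, the constraint map \<^const>\<open>Upsilon\<close> is affine, with linear
  part \<open>- T2 ** Xi Fi ** D1\<close>.\<close>

lemma svec_Upsilon:
  fixes D1 :: "real^(('n::finite + 'm::finite) uprod)^(('n + 'm) \<times> ('n + 'm))"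
    and T2 :: "real^('n \<times> 'n)^('n uprod)"
  assumes D1: "\<And>W. sym_mat W \<Longrightarrow> vec_mat W = D1 *v svec W"
    and T2: "\<And>S. sym_mat S \<Longrightarrow> svec S = T2 *v vec_mat S"
    and Q: "sym_mat Q" and W: "sym_mat W"
  shows "svec (Upsilon Q Fi W) =
    - (T2 *v (kron V2 V2 *v vec_mat Q)) - (T2 ** Xi Fi ** D1) *v svec W"
proof -
  let ?N = "Fi ** W + W ** transpose Fi"
  have N: "sym_mat ?N"
    using W by (simp add: sym_mat_def matrix_transpose_mul add.commute)
      (simp add: transpose_def vec_eq_iff matrix_matrix_mult_def mult.commute add.commute)
  have "(T2 ** Xi Fi ** D1) *v svec W = T2 *v (Xi Fi *v vec_mat W)"
    by (simp add: D1 [OF W] matrix_vector_mul_assoc matrix_mul_assoc)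
  also have "\<dots> = svec (V2 ** ?N ** transpose V2)"
    by (simp add: Xi_vec_mat T2 [OF sym_mat_congruence [OF N]])
  finally have 1: "(T2 ** Xi Fi ** D1) *v svec W = svec (V2 ** ?N ** transpose V2)" .
  have 2: "T2 *v (kron V2 V2 *v vec_mat Q) = svec (V2 ** Q ** transpose V2)"
    by (simp add: kron_vec_mat T2 [OF sym_mat_congruence [OF Q]])
  show ?thesis
    unfolding 1 2 Upsilon_def
    by (simp add: V2_congruence svec_def upper_left_def vec_eq_iff)
qed

lemma sym_mat_gram: "sym_mat (B ** transpose B)"
  by (simp add: sym_mat_def matrix_transpose_mul)

lemma upper_left_block_mat: "upper_left (block_mat P11 P12 P21 P22) = P11"
  by (simp add: upper_left_def block_mat_def vec_eq_iff)

lemma sym_mat_block_diagonal: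
  assumes "sym_mat P"
  shows "sym_mat (block_mat P 0 0 0)"
  using sym_mat_entry [OF assms]
  by (auto simp: sym_mat_def transpose_def vec_eq_iff block_mat_def split: sum.splits)

section \<open>The sublinear rate for the dual function\<close>

lemma gradient_step_eq:
  fixes h l g x :: "'a::real_vector"
  assumes "h - l = - g" "r > 0"
  shows "inverse r *\<^sub>R (h + r *\<^sub>R x - l) = x - (1 / r) *\<^sub>R g"
proof -
  have "h + r *\<^sub>R x - l = r *\<^sub>R x - g" using assms(1) by (simp add: algebra_simps)
  then show ?thesis
    using assms(2) by (simp only: scaleR_diff_right) (simp add: inverse_eq_divide)
qed

lemma Omega_feasible:
  assumes "X0 \<in> Gamma_plus" "\<And>i. i \<in> {1..M} \<Longrightarrow> X i \<in> Gamma_plus"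
  shows "Omega Q R F M D1 T2 \<beta> \<xi> X0 X = ereal (
       - ((\<Sum>i=1..M. X i) \<bullet> (T2 *v (kron V2 V2 *v vec_mat Q)))
       - Lstar R F M D1 T2 X0 X \<bullet> (matrix_inv (transpose D1 ** D1) *v (transpose D1 *v \<xi>))
       + 1 / (2 * \<beta>) *
         (norm (psd_sqrt (matrix_inv (transpose D1 ** D1)) *v Lstar R F M D1 T2 X0 X))\<^sup>2)"
  using assms by (simp add: Omega_def indicator_ereal_def)

lemma Omega_infeasible:
  assumes "\<not> (X0 \<in> Gamma_plus \<and> (\<forall>i\<in>{1..M}. X i \<in> Gamma_plus))"
  shows "Omega Q R F M D1 T2 \<beta> \<xi> X0 X = \<infinity>"
proof (cases "\<forall>i\<in>{1..M}. X i \<in> Gamma_plus")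
  case True
  then show ?thesis using assms by (simp add: Omega_def indicator_ereal_def)
next
  case False
  then have "(\<Sum>i=1..M. indicator_ereal Gamma_plus (X i)) = \<infinity>"
    unfolding sum_Pinfty by (auto simp: indicator_ereal_def)
  then show ?thesis unfolding Omega_def by simp
qed

theorem proposition1:
  fixes A :: "real^'n^'n" and B2 :: "real^'m^'n" and B1 :: "real^'l^'n"
    and C :: "real^'n^'q" and D :: "real^'m^'q"
    and M :: nat
    and A_i :: "nat \<Rightarrow> real^'n^'n" and B2_i :: "nat \<Rightarrow> real^'m^'n"
    and Q R :: "real^('n + 'm)^('n + 'm)"
    and F :: "nat \<Rightarrow> real^('n + 'm)^('n + 'm)"
    and D1 :: "real^(('n + 'm) uprod)^(('n + 'm) \<times> ('n + 'm))"
    and T2 :: "real^('n \<times> 'n)^('n uprod)"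
    and \<beta> :: real and \<xi> :: "real^(('n + 'm) \<times> ('n + 'm))"
    and X0 :: "nat \<Rightarrow> real^(('n + 'm) uprod)"
    and X :: "nat \<Rightarrow> nat \<Rightarrow> real^('n uprod)"
  assumes M: "M \<ge> 1"
    and Q: "Q = block_mat (B1 ** transpose B1) 0 0 0"
    and R: "R = block_mat (transpose C ** C) 0 0 (transpose D ** D)"
    and F: "\<And>i. i \<in> {1..M} \<Longrightarrow> F i = block_mat (A_i i) (B2_i i) 0 0"
    and CD: "transpose C ** D = 0"
    and DD: "posdef (transpose D ** D)"
    and CC: "posdef (transpose C ** C)"
    and BB: "posdef (B1 ** transpose B1)"
    and stab: "stabilizable A B2"
    and unobs: "\<And>c. unobservable_mode A C c \<Longrightarrow> Re c \<noteq> 0"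
    and hull: "block_mat A B2 0 0 \<in> convex hull (F ` {1..M})"
    and strict_feas: "\<exists>W. posdef W \<and> (\<forall>i\<in>{1..M}. posdef (Upsilon Q (F i) W))"
    and block_pos: "\<And>W. psd W \<Longrightarrow> (\<And>i. i \<in> {1..M} \<Longrightarrow> psd (Upsilon Q (F i) W))
                      \<Longrightarrow> posdef (upper_left W)"
    and D1: "\<And>W. sym_mat W \<Longrightarrow> vec_mat W = D1 *v svec W"
    and T2: "\<And>S. sym_mat S \<Longrightarrow> svec S = T2 *v vec_mat S"
    and \<beta>: "\<beta> > 0"
    and iter: "\<And>k. pbcd_sweep Q R F M D1 T2 \<beta> \<xi> (X0 k) (X k) (X0 (Suc k)) (X (Suc k))"
  shows "\<exists>c::real. \<forall>k\<ge>1.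
           Omega Q R F M D1 T2 \<beta> \<xi> (X0 k) (X k)
             - (INF (Y0, Y)\<in>UNIV. Omega Q R F M D1 T2 \<beta> \<xi> Y0 Y)
           \<le> ereal (c / real k)"
proof -
  define K where "K = diag_mat (\<lambda>u :: ('n + 'm) uprod. 1 / mult_pos u)"
  define G where "G i = T2 ** Xi (F i) ** D1" for i
  define P where "P v = (1 / \<beta>) *\<^sub>R (K *v v)" for v
  define a where "a = K *v (transpose D1 *v \<xi>)"
  define b where "b = T2 *v (kron V2 V2 *v vec_mat Q)"
  define c where "c = transpose D1 *v vec_mat R"
  define \<rho>0 where "\<rho>0 = max_eigenvalue (L_mat0 D1 \<beta>)"
  define \<rho> where "\<rho> i = max_eigenvalue (L_mat F D1 T2 \<beta> i)" for i
  have gram: "transpose D1 ** D1 = diag_mat mult_pos"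
    by (rule duplication_matrix_gram [OF D1])
  have inv: "matrix_inv (transpose D1 ** D1) = K"
    unfolding gram K_def by (rule matrix_inv_diag_mat) (metis less_irrefl mult_pos_pos)
  have symK: "sym_mat K" unfolding K_def by (rule sym_diag_mat)
  have psdK: "psd K" unfolding K_def by (rule psd_diag_mat) (simp add: less_imp_le mult_pos_pos)
  have posK: "0 < x \<bullet> (K *v x)" if "x \<noteq> 0" for x
  proof -
    have "x \<bullet> (K *v x) \<noteq> 0"
    proof
      assume "x \<bullet> (K *v x) = 0"
      then have "K *v x = 0" using psdK by (simp add: psd_form_zeroD)
      then have "x $ u = 0" for u
        using mult_pos_pos [of u] by (auto simp: K_def diag_mat_vector vec_eq_iff dest: spec [of _ u])
      then show False using that by (simp add: vec_eq_iff)
    qed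
    then show ?thesis using psdK by (simp add: psd_def less_le)
  qed
  \<comment> \<open>\<open>K\<close> is diagonal, so its positive semidefinite root can be written down.\<close>
  have sqrt: "(norm (psd_sqrt K *v x))\<^sup>2 = x \<bullet> (K *v x)" for x
  proof (rule norm_psd_sqrt)
    show "psd (diag_mat (\<lambda>u :: ('n + 'm) uprod. 1 / sqrt (mult_pos u)))"
      by (rule psd_diag_mat) (simp add: less_imp_le mult_pos_pos)
    show "diag_mat (\<lambda>u :: ('n + 'm) uprod. 1 / sqrt (mult_pos u)) **
        diag_mat (\<lambda>u. 1 / sqrt (mult_pos u)) = K"
      by (simp add: diag_mat_mult K_def abs_of_pos mult_pos_pos)
  qed
  have linP: "linear P"
    unfolding P_def by (intro linear_compose_scale_right matrix_vector_mul_linear)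
  have Lm0: "L_mat0 D1 \<beta> *v h = P h" for h
    by (simp add: L_mat0_def inv P_def scaleR_matrix_vector_assoc)
  have trG: "transpose (G i) = transpose D1 ** transpose (Xi (F i)) ** transpose T2" for i
    by (simp add: G_def matrix_transpose_mul matrix_mul_assoc)
  have Lm: "L_mat F D1 T2 \<beta> i = (1 / \<beta>) *\<^sub>R (G i ** K ** transpose (G i))" for i
    by (simp add: L_mat_def inv trG matrix_mul_assoc) (simp add: G_def)
  have Lmv: "L_mat F D1 T2 \<beta> i *v h = G i *v P (transpose (G i) *v h)" for i h
    by (simp add: Lm P_def matrix_vector_mul_assoc [symmetric] scaleR_matrix_vector_assoc [symmetric]
        matrix_vector_mult_scaleR)
  have sym0: "sym_mat (L_mat0 D1 \<beta>)"
    using symK by (simp add: L_mat0_def inv sym_mat_def transpose_scalar)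
  have symL: "sym_mat (L_mat F D1 T2 \<beta> i)" for i
    using sym_mat_congruence [OF symK, of "G i"] by (simp add: Lm sym_mat_def transpose_scalar)
  have GT: "(transpose (G i) *v x) \<bullet> y = x \<bullet> (G i *v y)" for i x y
    by (rule inner_matrix_transpose [symmetric])
  obtain W where W: "posdef W" "\<And>i. i \<in> {1..M} \<Longrightarrow> posdef (Upsilon Q (F i) W)"
    using strict_feas by blast
  define w where "w = svec W"
  have symW: "sym_mat W" using W(1) by (simp add: posdef_def)
  have symQ: "sym_mat Q" unfolding Q by (intro sym_mat_block_diagonal sym_mat_gram)
  have Ups: "svec (Upsilon Q (F i) W) = - b - G i *v w" for i
    unfolding b_def G_def w_def by (rule svec_Upsilon [OF D1 T2 symQ symW])
  \<comment> \<open>If \<open>G i\<close> vanished, then \<open>Upsilon Q (F i) W\<close> would be the negative definite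
    \<open>- B1 ** transpose B1\<close>.\<close>
  have G_ne: "\<exists>h. transpose (G i) *v h \<noteq> 0" if i: "i \<in> {1..M}" for i
  proof (rule ccontr)
    assume "\<not> ?thesis"
    then have "x \<bullet> (G i *v w) = 0" for x using GT [of i x w] by simp
    then have "G i *v w = 0" by (metis inner_eq_zero_iff)
    then have sv: "svec (Upsilon Q (F i) W) = - b" by (simp add: Ups)
    have "b = svec (B1 ** transpose B1)"
      unfolding b_def by (simp add: kron_vec_mat T2 [OF sym_mat_gram]
          V2_congruence Q upper_left_block_mat)
    then have "b $ Upair j j = (B1 ** transpose B1) $ j $ j" for j
      by (simp add: svec_Upair [OF sym_mat_gram])
    moreover have "(- b) $ Upair j j = Upsilon Q (F i) W $ j $ j" for j
      using W(2) [OF i] unfolding sv [symmetric] by (simp add: svec_Upair posdef_def)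
    moreover have diag: "S $ j $ j > 0" if "posdef S" for S :: "real^'n^'n" and j
      using that by (metis axis_eq_0_iff inner_axis_matrix posdef_def zero_neq_one)
    ultimately show False
      using diag [OF BB] diag [OF W(2) [OF i]] by (metis neg_0_less_iff_less order_less_asym' vector_uminus_component)
  qed
  interpret quadratic_blocks P a c "\<lambda>i x. transpose (G i) *v x" "\<lambda>i x. G i *v x" b M
    Gamma_plus Gamma_plus \<rho>0 \<rho>
  proof (rule quadratic_blocks.intro)
    show "linear P" by (rule linP)
    show "x \<bullet> P y = P x \<bullet> y" for x y
      using sym_mat_inner [OF symK, of x y] by (simp add: P_def)
    show "0 \<le> x \<bullet> P x" for x using psdK \<beta> by (simp add: P_def psd_def)
    show "closed (Gamma_plus :: (real^('n uprod)) set)" "closed (Gamma_plus :: (real^(('n + 'm) uprod)) set)"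
      by (rule closed_Gamma_plus)+
    show "convex (Gamma_plus :: (real^('n uprod)) set)" "convex (Gamma_plus :: (real^(('n + 'm) uprod)) set)"
      by (rule convex_Gamma_plus)+
    show "(Gamma_plus :: (real^('n uprod)) set) \<noteq> {}" "(Gamma_plus :: (real^(('n + 'm) uprod)) set) \<noteq> {}"
      using zero_in_Gamma_plus by blast+
    show "h \<bullet> P h \<le> \<rho>0 * (h \<bullet> h)" for h
      using Rayleigh_le_max_eigenvalue [OF sym0, of h] by (simp add: Lm0 \<rho>0_def)
    show "\<rho>0 > 0"
      unfolding \<rho>0_def
    proof (rule max_eigenvalue_pos [OF sym0])
      show "0 < axis undefined 1 \<bullet> (L_mat0 D1 \<beta> *v axis undefined 1)"
        using posK [of "axis undefined 1"] \<beta> by (simp add: Lm0 P_def axis_eq_0_iff)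
    qed
    fix i assume i: "i \<in> {1..M}"
    show "(transpose (G i) *v h) \<bullet> P (transpose (G i) *v h) \<le> \<rho> i * (h \<bullet> h)" for h
      using Rayleigh_le_max_eigenvalue [OF symL, of h i] by (simp add: GT Lmv \<rho>_def)
    obtain h where h: "transpose (G i) *v h \<noteq> 0" using G_ne [OF i] by blast
    show "\<rho> i > 0"
      unfolding \<rho>_def
    proof (rule max_eigenvalue_pos [OF symL])
      show "0 < h \<bullet> (L_mat F D1 T2 \<beta> i *v h)"
        unfolding Lmv GT [symmetric] using posK [OF h] \<beta> by (simp add: P_def)
    qed
  qed (rule GT matrix_vector_mul_linear)+
  have residual_eq: "residual = Lstar R F M D1 T2"
    unfolding fun_eq_iff residual_def
    by (simp add: Lstar_def c_def trG matrix_vector_mul_assoc [symmetric]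
        linear_sum [OF matrix_vector_mul_linear])
  have feasible_iff: "feasible Y0 Y \<longleftrightarrow> Y0 \<in> Gamma_plus \<and> (\<forall>i\<in>{1..M}. Y i \<in> Gamma_plus)" for Y0 Y
    by (simp add: feasible_def)
  have Omega_eq: "Omega Q R F M D1 T2 \<beta> \<xi> Y0 Y = ereal (objective Y0 Y)" if "feasible Y0 Y" for Y0 Y
  proof -
    let ?l = "Lstar R F M D1 T2 Y0 Y"
    have "Omega Q R F M D1 T2 \<beta> \<xi> Y0 Y = ereal (- ((\<Sum>i=1..M. Y i) \<bullet> b) - ?l \<bullet> a
        + 1 / (2 * \<beta>) * (norm (psd_sqrt K *v ?l))\<^sup>2)"
      unfolding a_def b_def inv [symmetric] using that by (intro Omega_feasible) (auto simp: feasible_iff)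
    moreover have "1 / (2 * \<beta>) * (norm (psd_sqrt K *v ?l))\<^sup>2 = ?l \<bullet> P ?l / 2"
      by (simp add: sqrt P_def)
    moreover have "objective Y0 Y = - ((\<Sum>i=1..M. Y i) \<bullet> b) - ?l \<bullet> a + ?l \<bullet> P ?l / 2"
      by (simp add: objective_def quad_def residual_eq inner_sum_left)
    ultimately show ?thesis by (simp only:)
  qed
  \<comment> \<open>\<open>H\<^sub>i - L\<^sub>i X\<^sub>i\<close> is the negative partial gradient, so \<open>\<Delta>\<^sub>i\<close> is a gradient step of
    length \<open>1 / \<rho>\<^sub>i\<close>.\<close>
  have sweep: "sweep (X0 k) (X k) (X0 (Suc k)) (X (Suc k))" for k
    unfolding sweep_def
  proof (intro conjI ballI)
    let ?u = "X0 k" and ?x = "X k" and ?v = "X0 (Suc k)" and ?y = "X (Suc k)"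
    have it: "pbcd_sweep Q R F M D1 T2 \<beta> \<xi> ?u ?x ?v ?y" by (rule iter)
    {
      fix i assume i: "i \<in> {1..M}"
      let ?l = "residual ?u (mixed i ?x ?y)"
      have "H_vec Q R F M D1 T2 \<beta> \<xi> i ?u (mixed i ?x ?y) - L_mat F D1 T2 \<beta> i *v ?x i
          = - (G i *v (P ?l - a) - b)"
      proof -
        have 1: "Lstar_minus R F M D1 T2 i ?u (mixed i ?x ?y) = ?l - transpose (G i) *v ?x i"
          unfolding residual_eq
          by (simp add: Lstar_minus_def trG matrix_vector_mul_assoc [symmetric]) (simp add: mixed_def)
        have 2: "H_vec Q R F M D1 T2 \<beta> \<xi> i ?u (mixed i ?x ?y)
            = b + G i *v a - G i *v P (?l - transpose (G i) *v ?x i)"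
          unfolding H_vec_def 1 inv
          by (simp add: G_def b_def a_def P_def matrix_vector_mul_assoc [symmetric]
              matrix_vector_mult_scaleR)
        show ?thesis
          unfolding 2 Lmv
          by (simp add: linear_diff [OF linP] matrix_vector_mult_diff_distrib)
      qed
      then have "inverse (\<rho> i) *\<^sub>R (H_vec Q R F M D1 T2 \<beta> \<xi> i ?u (mixed i ?x ?y) + \<rho> i *\<^sub>R ?x i
          - L_mat F D1 T2 \<beta> i *v ?x i) = ?x i - (1 / \<rho> i) *\<^sub>R (G i *v (P ?l - a) - b)"
        using \<rho>(1) [OF i] by (rule gradient_step_eq)
      then show "?y i = closest_point Gamma_plus (?x i - (1 / \<rho> i) *\<^sub>R (G i *v (P ?l - a) - b))"
        using it i by (simp add: pbcd_sweep_def Let_def \<rho>_def)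
    }
    let ?l = "residual ?u ?y"
    have "H_vec0 R F M D1 T2 \<beta> \<xi> ?u ?y - L_mat0 D1 \<beta> *v ?u = - (a - P ?l)"
      unfolding H_vec0_def Lstar_minus0_def inv Lm0
      by (simp add: a_def P_def residual_eq matrix_vector_right_distrib scaleR_add_right)
    then have "inverse \<rho>0 *\<^sub>R (H_vec0 R F M D1 T2 \<beta> \<xi> ?u ?y + \<rho>0 *\<^sub>R ?u - L_mat0 D1 \<beta> *v ?u)
        = ?u - (1 / \<rho>0) *\<^sub>R (a - P ?l)"
      using \<rho>0(1) by (rule gradient_step_eq)
    then show "?v = closest_point Gamma_plus (?u - (1 / \<rho>0) *\<^sub>R (a - P ?l))"
      using it by (simp add: pbcd_sweep_def Let_def \<rho>0_def)
  qed
  \<comment> \<open>Strict feasibility of \<open>W\<close> puts \<open>w\<close> and the \<open>- b - G i *v w\<close> in the interior of the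
    dual cones, which is what \<open>objective_coercive\<close> asks for.\<close>
  have "\<exists>\<kappa>>0. (\<forall>v\<in>Gamma_plus. \<kappa> * norm v \<le> v \<bullet> w) \<and>
      (\<forall>i\<in>{1..M}. \<forall>v\<in>Gamma_plus. \<kappa> * norm v \<le> v \<bullet> (- b - G i *v w))"
  proof -
    obtain k0 where k0: "k0 > 0" "\<And>v. v \<in> Gamma_plus \<Longrightarrow> k0 * norm v \<le> v \<bullet> w"
      using posdef_inner_Gamma_plus [of w] W(1) by (auto simp: w_def smat_svec [OF symW])
    have "\<exists>k>0. \<forall>v\<in>Gamma_plus. k * norm v \<le> v \<bullet> (- b - G i *v w)" if i: "i \<in> {1..M}" for i
    proof -
      have "posdef (smat (- b - G i *v w))"
        unfolding Ups [symmetric] using W(2) [OF i] by (simp add: smat_svec posdef_def)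
      then show ?thesis using posdef_inner_Gamma_plus by metis
    qed
    then obtain k where k: "\<And>i. i \<in> {1..M} \<Longrightarrow> k i > 0"
      "\<And>i v. i \<in> {1..M} \<Longrightarrow> v \<in> Gamma_plus \<Longrightarrow> k i * norm v \<le> v \<bullet> (- b - G i *v w)"
      by metis
    define \<kappa> where "\<kappa> = Min (insert k0 (k ` {1..M}))"
    have "\<kappa> > 0" unfolding \<kappa>_def using k0 k by (subst Min_gr_iff) auto
    moreover have "\<kappa> \<le> k0" "\<And>i. i \<in> {1..M} \<Longrightarrow> \<kappa> \<le> k i" unfolding \<kappa>_def by (intro Min_le; simp)+
    ultimately show ?thesis
      using k0(2) k(2) by (meson mult_right_mono norm_ge_zero order_trans)
  qed
  then obtain \<kappa> where \<kappa>: "\<kappa> > 0" "\<And>v. v \<in> Gamma_plus \<Longrightarrow> \<kappa> * norm v \<le> v \<bullet> w"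
      "\<And>i v. i \<in> {1..M} \<Longrightarrow> v \<in> Gamma_plus \<Longrightarrow> \<kappa> * norm v \<le> v \<bullet> (- b - G i *v w)"
    by blast
  \<comment> \<open>The point at which the quadratic part has gradient \<open>- w\<close>.\<close>
  define u where "u = \<beta> *\<^sub>R (diag_mat mult_pos *v (a - w))"
  have Pu: "P u = a - w"
    using \<beta> by (simp add: less_imp_neq [OF mult_pos_pos, symmetric] P_def u_def K_def matrix_vector_mult_scaleR
        diag_mat_vector vec_eq_iff)
  have coercive: "\<kappa> * (norm Y0 + (\<Sum>i=1..M. norm (Y i))) - (c \<bullet> w - u \<bullet> w - quad u)
      \<le> objective Y0 Y" if "feasible Y0 Y" for Y0 Y
    using Pu \<kappa>(2,3) that by (rule objective_coercive)
  obtain r where r: "\<And>k Y0 Y. k \<ge> 1 \<Longrightarrow> feasible Y0 Y \<Longrightarrow>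
      objective (X0 k) (X k) - objective Y0 Y \<le> r / real k"
    using sweep_rate [where ?x0.0 = X0 and ?x = X, OF \<kappa>(1) coercive sweep] by blast
  show ?thesis
  proof (intro exI [of _ r] allI impI)
    fix k :: nat assume k: "k \<ge> 1"
    have fk: "feasible (X0 k) (X k)"
      using sweep_feasible [OF sweep, of "k - 1"] k by simp
    have "ereal (objective (X0 k) (X k) - r / real k) \<le> Omega Q R F M D1 T2 \<beta> \<xi> Y0 Y" for Y0 Y
    proof (cases "feasible Y0 Y")
      case True
      then show ?thesis using r [OF k True] by (simp add: Omega_eq)
    next
      case False
      then show ?thesis by (simp add: feasible_iff Omega_infeasible)
    qed
    then have "ereal (objective (X0 k) (X k) - r / real k)
        \<le> (INF (Y0, Y)\<in>UNIV. Omega Q R F M D1 T2 \<beta> \<xi> Y0 Y)"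
      by (intro INF_greatest) auto
    then have "Omega Q R F M D1 T2 \<beta> \<xi> (X0 k) (X k) - (INF (Y0, Y)\<in>UNIV. Omega Q R F M D1 T2 \<beta> \<xi> Y0 Y)
        \<le> ereal (objective (X0 k) (X k)) - ereal (objective (X0 k) (X k) - r / real k)"
      unfolding Omega_eq [OF fk] by (intro ereal_minus_mono order_refl)
    then show "Omega Q R F M D1 T2 \<beta> \<xi> (X0 k) (X k) - (INF (Y0, Y)\<in>UNIV. Omega Q R F M D1 T2 \<beta> \<xi> Y0 Y)
        \<le> ereal (r / real k)"
      by simp
  qed
qed

end
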